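(* Let $n\geq 2$ and let $\mathcal{C}_n=\mathrm{span}_{\mathbb{Q}}\{X_G:\ G\text{ a connected }n\text{-vertex simple graph}\}$. Then $$\mathcal{C}_n=\left\{\sum_{\lambda\vdash n}a_\lambda\,\mathfrak{st}_\lambda:\ a_\lambda\in\mathbb{Q},\ a_{1^n}=0\right\}.$$ Moreover, the set $B\cup B'$ is a basis for $\mathcal{C}_n$, where $$B=\{X_{\mathrm{Cat}_{\lambda_2\lambda_3\cdots\lambda_\ell\lambda_1}}:\ \lambda=\lambda_1\lambda_2\cdots\lambda_\ell\vdash n,\ \text{either }\lambda=n\text{ or }\lambda_2\geq 2\},\qquad B'=\{X_{\mathrm{Cut}_{c,n-c}}:\ 3\leq c\leq n\}.$$
   Context: For a finite simple graph $G=(V,E)$, a proper colouring is a function $\kappa:V\to\{1,2,3,\ldots\}$ with $\kappa(u)\neq\kappa(v)$ whenever $\{u,v\}\in E$. The chromatic symmetric function of $G$ is $X_G=\sum_{\kappa\text{ proper}}\prod_{v\in V}x_{\kappa(v)}$, a symmetric function in commuting variables $x_1,x_2,\ldots$, homogeneous of degree $|V|$. The star $\mathrm{St}_k$ is the $k$-vertex tree in which $k-1$ leaves are joined to a single central vertex ($\mathrm{St}_1$ is a single vertex). For a partition $\lambda=(\lambda_1\geq\cdots\geq\lambda_\ell)$ of $n$, $\mathrm{St}_\lambda$ is the disjoint union of $\mathrm{St}_{\lambda_1},\ldots,\mathrm{St}_{\lambda_\ell}$, and $\mathfrak{st}_\lambda=X_{\mathrm{St}_\lambda}$. It is known that $\{\mathfrak{st}_\lambda:\lambda\vdash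 n\}$ is a basis (over $\mathbb{Q}$) of the space of symmetric functions of degree $n$. The partition $1^n$ has $n$ parts equal to $1$. For a composition $\alpha=\alpha_1\cdots\alpha_\ell$ of $n$ with $\alpha_1,\alpha_\ell\geq 2$, the caterpillar $\mathrm{Cat}_\alpha$ is the $n$-vertex tree formed by taking a path of $\ell$ vertices $v_1,\ldots,v_\ell$ and attaching $\alpha_i-1$ leaves to $v_i$ for each $1\leq i\leq\ell$; in particular $\mathrm{Cat}_n=\mathrm{St}_n$ for the one-part composition $n$. The indexing composition $\lambda_2\lambda_3\cdots\lambda_\ell\lambda_1$ is the partition with its largest part moved to the end. For $c\geq 3$ and $\ell\geq 0$, the cuttlefish $\mathrm{Cut}_{c,\ell}$ is the $(c+\ell)$-vertex graph formed by taking a cycle of $c$ vertices and attaching $\ell$ leaves to one fixed vertex of the cycle. *)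

theory Defs
  imports
    Complex_Main
    "HOL-Library.Multiset"
    "HOL-Library.FuncSet"
    "HOL-Library.Function_Algebras"
begin

section \<open>Finite simple graphs\<close>

datatype 'a graph = Graph (verts: "'a set") (edges: "'a set set")

definition simple_graph :: "'a graph \<Rightarrow> bool" where
  "simple_graph G \<longleftrightarrow> finite (verts G) \<and> (\<forall>e\<in>edges G. e \<subseteq> verts G \<and> card e = 2)"

definition connected_graph :: "'a graph \<Rightarrow> bool" where
  "connected_graph G \<longleftrightarrow> verts G \<noteq> {} \<and>
     (\<forall>u\<in>verts G. \<forall>v\<in>verts G. (u, v) \<in> {(x, y). {x, y} \<in> edges G}\<^sup>*)"


section \<open>Chromatic symmetric functions\<close>

text \<open>
  A formal power series over the rationals in the commuting variables
  \<open>x\<^sub>1, x\<^sub>2, \<dots>\<close> is given by its coefficients; a monomial is the finite multiset of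
  the indices of its variables. Addition and zero are the pointwise ones of
  \<^theory>\<open>HOL-Library.Function_Algebras\<close> (the pointwise product defined there is not the
  product of power series and is not used). The index 0 never occurs in a monomial with nonzero
  coefficient in the series below, as colours start at 1.
\<close>

type_synonym series = "nat multiset \<Rightarrow> rat"

definition qscale :: "rat \<Rightarrow> series \<Rightarrow> series" where
  "qscale c f = (\<lambda>m. c * f m)"

global_interpretation series: vector_space qscale
  by unfold_locales (auto simp: qscale_def fun_eq_iff algebra_simps)

definition proper_colourings :: "'a graph \<Rightarrow> ('a \<Rightarrow> nat) set" where
  "proper_colourings G =
     {\<kappa> \<in> verts G \<rightarrow>\<^sub>E {1..}. \<forall>u v. {u, v} \<in> edges G \<longrightarrow> \<kappa> u \<noteq> \<kappa> v}"

text \<open>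
  The monomial of a colouring \<open>\<kappa>\<close> is the product of the \<open>x\<^bsub>\<kappa> v\<^esub>\<close> over all vertices \<open>v\<close>, so
  the coefficient of a monomial in \<open>X\<^sub>G\<close> is the number of proper colourings with that monomial.
\<close>

definition colouring_monomial :: "'a graph \<Rightarrow> ('a \<Rightarrow> nat) \<Rightarrow> nat multiset" where
  "colouring_monomial G \<kappa> = image_mset \<kappa> (mset_set (verts G))"

definition csf :: "'a graph \<Rightarrow> series" where
  "csf G = (\<lambda>m. of_nat (card {\<kappa> \<in> proper_colourings G. colouring_monomial G \<kappa> = m}))"

lemma finite_colourings_with_monomial:
  assumes "finite (verts G)"
  shows "finite {\<kappa> \<in> proper_colourings G. colouring_monomial G \<kappa> = m}"
proof (rule finite_subset)
  show "{\<kappa> \<in> proper_colourings G. colouring_monomial G \<kappa> = m} \<subseteq> verts G \<rightarrow>\<^sub>E set_mset m"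
    using assms by (auto simp: proper_colourings_def colouring_monomial_def PiE_iff extensional_def)
  show "finite (verts G \<rightarrow>\<^sub>E set_mset m)"
    using assms by (intro finite_PiE) auto
qed

text \<open>
  Every finite graph is isomorphic to one whose vertices are natural numbers, and \<open>X\<^sub>G\<close> only
  depends on the isomorphism class of \<open>G\<close>; hence it suffices to let \<open>G\<close> range over those.
\<close>

definition connected_csf_space :: "nat \<Rightarrow> series set" where
  "connected_csf_space n =
     series.span {csf G | G :: nat graph.
       simple_graph G \<and> connected_graph G \<and> card (verts G) = n}"


section \<open>Partitions\<close>

definition partitions :: "nat \<Rightarrow> nat list set" where
  "partitions n = {p. sorted_wrt (\<ge>) p \<and> (\<forall>k\<in>set p. k \<ge> 1) \<and> sum_list p = n}"

lemma finite_partitions: "finite (partitions n)"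
proof (rule finite_subset)
  have "length xs \<le> sum_list xs" if "\<forall>k\<in>set xs. k \<ge> 1" for xs :: "nat list"
    using that by (induction xs) auto
  then show "partitions n \<subseteq> {xs. set xs \<subseteq> {..n} \<and> length xs \<le> n}"
    by (auto simp: partitions_def member_le_sum_list)
  show "finite {xs. set xs \<subseteq> {..n} \<and> length xs \<le> n}"
    by (rule finite_lists_length_le) simp
qed


section \<open>Stars, caterpillars and cuttlefish\<close>

text \<open>
  In \<open>star_forest p\<close> and \<open>caterpillar \<alpha>\<close>, the vertex \<open>(i, 0)\<close> is the centre of the \<open>i\<close>-th star,
  respectively the path vertex \<open>v\<^sub>i\<close> (counting from 0), and \<open>(i, j)\<close> with \<open>j > 0\<close> are the leaves
  attached to it. \<open>caterpillar \<alpha>\<close> is the intended object only for \<open>\<alpha>\<close> with positive entries whose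
  first and last entries are at least 2, and \<open>cuttlefish c l\<close> only for \<open>c \<ge> 3\<close>.
\<close>

definition star_forest :: "nat list \<Rightarrow> (nat \<times> nat) graph" where
  "star_forest p = Graph
     {(i, j). i < length p \<and> j < p ! i}
     {{(i, 0), (i, j)} | i j. i < length p \<and> 0 < j \<and> j < p ! i}"

definition caterpillar :: "nat list \<Rightarrow> (nat \<times> nat) graph" where
  "caterpillar \<alpha> = Graph
     {(i, j). i < length \<alpha> \<and> j < \<alpha> ! i}
     ({{(i, 0), (Suc i, 0)} | i. Suc i < length \<alpha>} \<union>
      {{(i, 0), (i, j)} | i j. i < length \<alpha> \<and> 0 < j \<and> j < \<alpha> ! i})"

definition cuttlefish :: "nat \<Rightarrow> nat \<Rightarrow> nat graph" where
  "cuttlefish c l = Graph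
     {..<c + l}
     ({{i, Suc i mod c} | i. i < c} \<union> {{0, c + j} | j. j < l})"

definition star_csf :: "nat list \<Rightarrow> series" where
  "star_csf p = csf (star_forest p)"

text \<open>For \<open>p = p\<^sub>1p\<^sub>2\<dots>p\<^sub>l\<close>, \<^term>\<open>rotate1 p\<close> is \<open>p\<^sub>2\<dots>p\<^sub>lp\<^sub>1\<close>, and \<open>p\<^sub>2\<close> is \<^term>\<open>p ! 1\<close>.\<close>

definition caterpillar_csfs :: "nat \<Rightarrow> series set" where
  "caterpillar_csfs n = {csf (caterpillar (rotate1 p)) | p.
     p \<in> partitions n \<and> (p = [n] \<or> length p \<ge> 2 \<and> p ! 1 \<ge> 2)}"

definition cuttlefish_csfs :: "nat \<Rightarrow> series set" where
  "cuttlefish_csfs n = {csf (cuttlefish c (n - c)) | c. 3 \<le> c \<and> c \<le> n}"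

end

theory Submission
  imports Defs "HOL-Combinatorics.Permutations"
begin

text \<open>
  Throughout, \<open>st\<^bsub>\<lambda>\<^esub>\<close> is the chromatic symmetric function of the star forest of \<open>\<lambda>\<close>, and all
  graphs are expanded in the \<open>st\<^bsub>\<lambda>\<^esub>\<close> by one relation. Let \<open>uv\<close> be an edge of \<open>G\<close>. As far as
  colourings with \<open>\<kappa> u = \<kappa> v\<close> are concerned, every other edge at \<open>v\<close> may be moved to \<open>u\<close>. If \<open>H\<close> is
  obtained from \<open>G - uv\<close> in this way, then \<open>G - uv\<close> and \<open>H\<close> have the same colourings with
  \<open>\<kappa> u = \<kappa> v\<close>, and so \<open>X\<^bsub>G\<^esub> = X\<^bsub>G-uv\<^esub> - X\<^bsub>H\<^esub> + X\<^bsub>H+uv\<^esub>\<close>, where \<open>v\<close> is isolated in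
  \<open>H\<close> and a leaf in \<open>H+uv\<close>. For graphs with pendant leaves at the vertices of a base graph
  (\<open>pendant_graph\<close>) all three graphs on the right have fewer base edges, whence
  \<open>X\<^bsub>G\<^esub>\<close> is a combination of the \<open>st\<^bsub>\<lambda>\<^esub>\<close> with \<open>\<lambda> \<turnstile> n\<close> (\<open>csf_in_span_stars\<close>). Only an edgeless
  graph can be properly coloured with one colour. Comparing the coefficients of \<open>x\<^sub>1\<^sup>n\<close> therefore
  shows that \<open>st\<^bsub>1^n\<^esub>\<close> does not occur in \<open>X\<^bsub>G\<^esub>\<close> as soon as \<open>G\<close> has an edge.

  The \<open>st\<^bsub>\<lambda>\<^esub>\<close> are linearly independent for reasons of dimension: the complete multipartite graph
  with parts of sizes \<open>\<lambda>\<close> has no colouring with fewer than \<open>length \<lambda>\<close> colours, and with exactly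
  that many only those that are constant on each part. Hence these functions are triangular with
  respect to monomials, and they are as many independent elements of the span of the \<open>st\<^bsub>\<lambda>\<^esub>\<close> as there
  are partitions (\<open>star_csf_basis\<close>).

  What remains is to write each \<open>st\<^bsub>\<lambda>\<^esub>\<close> with \<open>\<lambda> \<noteq> 1\<^sup>n\<close> in terms of the given caterpillars and
  cuttlefish. There are no more of those than such partitions, so that spanning implies
  independence. The induction is on the number of parts of \<open>\<lambda>\<close>, then on the number of parts that
  exceed 1. Resolving the last spine edge of a caterpillar, between stars of sizes \<open>a\<close> and \<open>b\<close>, gives
  \<open>st\<^bsub>a\<^esub>st\<^bsub>b\<^esub> - st\<^bsub>a+b-1\<^esub>st\<^bsub>1\<^esub> + st\<^bsub>a+b\<^esub>\<close>. Here the last term has fewer parts, and the middle one has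
  as many parts but fewer exceeding 1 if \<open>a, b \<ge> 2\<close>; if \<open>a = 1\<close> and there is more spine behind it,
  the first term contributes only fewer parts and the middle one moves the 1 out of the spine with a
  sign. So if \<open>\<lambda>\<^sub>2 \<ge> 2\<close>, the caterpillar of \<open>\<lambda>\<^sub>2\<dots>\<lambda>\<^sub>l\<lambda>\<^sub>1\<close>, whose 1s form a single run, is
  \<open>\<plusminus>st\<^bsub>\<lambda>\<^esub>\<close> plus lower terms (\<open>caterpillar_leading\<close>). For \<open>\<lambda> = n\<close> the
  caterpillar is a star. The partitions left over are the hooks, that is those with several parts of
  which exactly one exceeds 1. Put \<open>h = st\<^bsub>(l+2,1^(c-2))\<^esub>\<close> and
  \<open>d = st\<^bsub>(l+1,2,1^(c-3))\<^esub> - h\<close>. Modulo fewer than \<open>c - 1\<close> parts, the cuttlefish with cycle length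
  \<open>c\<close> and \<open>l\<close> leaves is \<open>\<plusminus>(h - (c-2)d)\<close> (\<open>cycle_csf_hook\<close>), while \<open>d\<close> is zero for \<open>l = 0\<close> and
  otherwise, up to sign and fewer parts, the caterpillar belonging to \<open>(l+1,2,1^(c-3))\<close>. Hence \<open>h\<close>
  is reached as well.
\<close>

section \<open>Isomorphism, deletion and contraction\<close>

text \<open>
  Injectivity on each edge is a form of properness that is transported by images of edge sets,
  without choosing names for the two ends of an edge.
\<close>

lemma proper_colourings_inj_on:
  assumes "simple_graph G"
  shows "proper_colourings G = {\<kappa> \<in> verts G \<rightarrow>\<^sub>E {1..}. \<forall>e\<in>edges G. inj_on \<kappa> e}"
proof -
  have "(\<forall>u v. {u, v} \<in> edges G \<longrightarrow> \<kappa> u \<noteq> \<kappa> v) \<longleftrightarrow> (\<forall>e\<in>edges G. inj_on \<kappa> e)" for \<kappa> :: "'a \<Rightarrow> nat"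
  proof safe
    fix e assume h: "\<forall>u v. {u, v} \<in> edges G \<longrightarrow> \<kappa> u \<noteq> \<kappa> v" "e \<in> edges G"
    then have "card e = 2" using assms by (auto simp: simple_graph_def)
    then obtain x y where "e = {x, y}" "x \<noteq> y" by (meson card_2_iff)
    then show "inj_on \<kappa> e" using h by auto
  next
    fix u v assume h: "\<forall>e\<in>edges G. inj_on \<kappa> e" "{u, v} \<in> edges G" "\<kappa> u = \<kappa> v"
    then have "inj_on \<kappa> {u, v}" by blast
    with h(3) have "u = v" by (meson inj_onD insertI1 insertI2)
    moreover have "card {u, v} = 2" using h assms by (auto simp: simple_graph_def)
    ultimately show False by simp
  qed
  then show ?thesis by (simp add: proper_colourings_def)
qed

lemma csf_inj_on_edges:
  assumes "simple_graph G"
  shows "csf G m = of_nat (card {\<kappa> \<in> verts G \<rightarrow>\<^sub>E {1..}.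
    (\<forall>e\<in>edges G. inj_on \<kappa> e) \<and> image_mset \<kappa> (mset_set (verts G)) = m})"
proof -
  have "{\<kappa> \<in> proper_colourings G. colouring_monomial G \<kappa> = m} = {\<kappa> \<in> verts G \<rightarrow>\<^sub>E {1..}.
    (\<forall>e\<in>edges G. inj_on \<kappa> e) \<and> image_mset \<kappa> (mset_set (verts G)) = m}"
    unfolding proper_colourings_inj_on[OF assms] colouring_monomial_def by auto
  then show ?thesis by (simp add: csf_def)
qed

lemma simple_graph_isomorphic:
  assumes "simple_graph G" "bij_betw f (verts G) (verts H)" "edges H = image f ` edges G"
  shows "simple_graph H"
proof -
  have i: "inj_on f (verts G)" and im: "f ` verts G = verts H"
    using assms(2) by (auto simp: bij_betw_def)
  have "card (f ` e) = 2" if "e \<in> edges G" for e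
    using that assms(1) i card_image[of f e] by (auto simp: simple_graph_def dest: inj_on_subset)
  then show ?thesis
    using assms(1) assms(3) unfolding simple_graph_def im[symmetric] by fastforce
qed

lemma csf_isomorphic:
  assumes G: "simple_graph G" and f: "bij_betw f (verts G) (verts H)"
    and E: "edges H = image f ` edges G"
  shows "csf G = csf H"
proof
  fix m :: "nat multiset"
  have H: "simple_graph H" using simple_graph_isomorphic[OF assms] .
  define g where "g = the_inv_into (verts G) f"
  have i: "inj_on f (verts G)" and im: "f ` verts G = verts H"
    using f by (auto simp: bij_betw_def)
  have gf: "g (f x) = x" if "x \<in> verts G" for x
    using that i by (simp add: g_def the_inv_into_f_f)
  have fin: "finite (verts G)" using G by (simp add: simple_graph_def)
  have sub: "e \<subseteq> verts G" if "e \<in> edges G" for e using G that by (auto simp: simple_graph_def)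
  have g: "g y \<in> verts G" "f (g y) = y" if "y \<in> verts H" for y
    using that gf unfolding im[symmetric] by auto
  have ms: "mset_set (verts H) = image_mset f (mset_set (verts G))"
    using i im by (simp add: image_mset_mset_set)
  let ?A = "{\<kappa> \<in> verts H \<rightarrow>\<^sub>E {1..}. (\<forall>e\<in>edges H. inj_on \<kappa> e) \<and> image_mset \<kappa> (mset_set (verts H)) = m}"
  let ?B = "{\<kappa> \<in> verts G \<rightarrow>\<^sub>E {1..}. (\<forall>e\<in>edges G. inj_on \<kappa> e) \<and> image_mset \<kappa> (mset_set (verts G)) = m}"
  have e1: "inj_on \<kappa> (f ` e) \<longleftrightarrow> inj_on (restrict (\<kappa> \<circ> f) (verts G)) e" if "e \<in> edges G" for \<kappa> :: "'b \<Rightarrow> nat" and e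
  proof -
    have "inj_on (restrict (\<kappa> \<circ> f) (verts G)) e \<longleftrightarrow> inj_on (\<kappa> \<circ> f) e"
      using sub[OF that] by (intro inj_on_cong) auto
    also have "\<dots> \<longleftrightarrow> inj_on \<kappa> (f ` e)"
      using comp_inj_on_iff[of f e \<kappa>] inj_on_subset[OF i sub[OF that]] by auto
    finally show ?thesis by simp
  qed
  have e2: "inj_on \<kappa> e \<longleftrightarrow> inj_on (restrict (\<kappa> \<circ> g) (verts H)) (f ` e)" if "e \<in> edges G" for \<kappa> :: "'a \<Rightarrow> nat" and e
  proof -
    have "restrict (restrict (\<kappa> \<circ> g) (verts H) \<circ> f) (verts G) x = \<kappa> x" if "x \<in> e" for x
      using that sub[OF \<open>e \<in> edges G\<close>] im gf by auto
    then show ?thesis unfolding e1[OF that] by (intro inj_on_cong) auto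
  qed
  have m1: "image_mset (restrict (\<kappa> \<circ> f) (verts G)) (mset_set (verts G)) = image_mset \<kappa> (mset_set (verts H))" for \<kappa> :: "'b \<Rightarrow> nat"
    unfolding ms multiset.map_comp using fin by (intro image_mset_cong) auto
  have m2: "image_mset (restrict (\<kappa> \<circ> g) (verts H)) (mset_set (verts H)) = image_mset \<kappa> (mset_set (verts G))" for \<kappa> :: "'a \<Rightarrow> nat"
    unfolding ms multiset.map_comp using fin gf im by (intro image_mset_cong) auto
  have "bij_betw (\<lambda>\<kappa>. restrict (\<kappa> \<circ> f) (verts G)) ?A ?B"
  proof (rule bij_betw_byWitness[where f' = "\<lambda>\<kappa>. restrict (\<kappa> \<circ> g) (verts H)"])
    show "\<forall>\<kappa>\<in>?A. restrict (restrict (\<kappa> \<circ> f) (verts G) \<circ> g) (verts H) = \<kappa>"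
      using g by (auto simp: fun_eq_iff PiE_iff extensional_def)
    show "\<forall>\<kappa>\<in>?B. restrict (restrict (\<kappa> \<circ> g) (verts H) \<circ> f) (verts G) = \<kappa>"
      using gf im by (auto simp: fun_eq_iff PiE_iff extensional_def)
    show "(\<lambda>\<kappa>. restrict (\<kappa> \<circ> f) (verts G)) ` ?A \<subseteq> ?B"
    proof (intro image_subsetI CollectI conjI ballI)
      fix \<kappa> :: "'b \<Rightarrow> nat" assume k: "\<kappa> \<in> ?A"
      show "restrict (\<kappa> \<circ> f) (verts G) \<in> verts G \<rightarrow>\<^sub>E {1..}" using k im by (auto simp: PiE_iff)
      show "inj_on (restrict (\<kappa> \<circ> f) (verts G)) e" if "e \<in> edges G" for e
        using k E that e1[OF that, of \<kappa>] by blast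
      show "image_mset (restrict (\<kappa> \<circ> f) (verts G)) (mset_set (verts G)) = m"
        using k m1 by auto
    qed
    show "(\<lambda>\<kappa>. restrict (\<kappa> \<circ> g) (verts H)) ` ?B \<subseteq> ?A"
    proof (intro image_subsetI CollectI conjI ballI)
      fix \<kappa> :: "'a \<Rightarrow> nat" assume k: "\<kappa> \<in> ?B"
      show "restrict (\<kappa> \<circ> g) (verts H) \<in> verts H \<rightarrow>\<^sub>E {1..}" using k g by (auto simp: PiE_iff)
      show "inj_on (restrict (\<kappa> \<circ> g) (verts H)) e" if e: "e \<in> edges H" for e
      proof -
        obtain e' where "e' \<in> edges G" "e = f ` e'" using e E by auto
        then show ?thesis using e2[of e' \<kappa>] k by auto
      qed
      show "image_mset (restrict (\<kappa> \<circ> g) (verts H)) (mset_set (verts H)) = m"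
        using k m2 by auto
    qed
  qed
  from bij_betw_same_card[OF this] show "csf G m = csf H m"
    unfolding csf_inj_on_edges[OF G] csf_inj_on_edges[OF H] by simp
qed

text \<open>
  The colourings that are lost when the edge \<open>uv\<close> is added are those with \<open>\<kappa> u = \<kappa> v\<close>.
\<close>

lemma csf_insert_edge:
  assumes "simple_graph (Graph V E)" "u \<in> V" "v \<in> V" "u \<noteq> v"
  shows "csf (Graph V (insert {u, v} E)) m = csf (Graph V E) m -
    of_nat (card {\<kappa> \<in> V \<rightarrow>\<^sub>E {1..}. (\<forall>e\<in>E. inj_on \<kappa> e) \<and> image_mset \<kappa> (mset_set V) = m \<and> \<kappa> u = \<kappa> v})"
proof -
  have s: "simple_graph (Graph V (insert {u, v} E))"
    using assms by (auto simp: simple_graph_def)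
  let ?A = "{\<kappa> \<in> V \<rightarrow>\<^sub>E {1..}. (\<forall>e\<in>E. inj_on \<kappa> e) \<and> image_mset \<kappa> (mset_set V) = m}"
  let ?B = "{\<kappa> \<in> V \<rightarrow>\<^sub>E {1..}. (\<forall>e\<in>E. inj_on \<kappa> e) \<and> image_mset \<kappa> (mset_set V) = m \<and> \<kappa> u = \<kappa> v}"
  have fin: "finite ?A"
    using finite_colourings_with_monomial[of "Graph V E" m] assms(1)
    by (simp add: simple_graph_def proper_colourings_inj_on[OF assms(1)] colouring_monomial_def conj_assoc)
  have "{\<kappa> \<in> V \<rightarrow>\<^sub>E {1..}. (\<forall>e\<in>insert {u, v} E. inj_on \<kappa> e) \<and> image_mset \<kappa> (mset_set V) = m} = ?A - ?B"
    using assms(4) by auto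
  moreover have "card (?A - ?B) = card ?A - card ?B"
    by (intro card_Diff_subset finite_subset[OF _ fin]) auto
  moreover have "card ?B \<le> card ?A" by (intro card_mono fin) auto
  ultimately show ?thesis
    unfolding csf_inj_on_edges[OF s] csf_inj_on_edges[OF assms(1)] by simp
qed

text \<open>
  Adding \<open>uv\<close> removes the same colourings from both graphs. The contraction of \<open>uv\<close> is encoded by
  the graph \<open>E'\<close>, on the same vertices, because the number of vertices has to be kept.
\<close>

lemma deletion_contraction:
  assumes "simple_graph (Graph V E)" "simple_graph (Graph V E')" "u \<in> V" "v \<in> V" "u \<noteq> v"
    and "\<And>\<kappa> :: 'a \<Rightarrow> nat. \<kappa> u = \<kappa> v \<Longrightarrow> (\<forall>e\<in>E. inj_on \<kappa> e) \<longleftrightarrow> (\<forall>e\<in>E'. inj_on \<kappa> e)"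
  shows "csf (Graph V (insert {u, v} E)) =
    csf (Graph V E) - csf (Graph V E') + csf (Graph V (insert {u, v} E'))"
proof
  fix m :: "nat multiset"
  have "{\<kappa> \<in> V \<rightarrow>\<^sub>E {1..}. (\<forall>e\<in>E. inj_on \<kappa> e) \<and> image_mset \<kappa> (mset_set V) = m \<and> \<kappa> u = \<kappa> v} =
    {\<kappa> \<in> V \<rightarrow>\<^sub>E {1..}. (\<forall>e\<in>E'. inj_on \<kappa> e) \<and> image_mset \<kappa> (mset_set V) = m \<and> \<kappa> u = \<kappa> v}"
    by (intro Collect_cong) (metis assms(6))
  then show "csf (Graph V (insert {u, v} E)) m =
    (csf (Graph V E) - csf (Graph V E') + csf (Graph V (insert {u, v} E'))) m"
    using csf_insert_edge[OF assms(1,3,4,5), of m] csf_insert_edge[OF assms(2,3,4,5), of m]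
    by (simp add: fun_diff_def plus_fun_def)
qed

section \<open>Graphs with pendant leaves\<close>

text \<open>
  The base graph \<open>E\<close> lives on the indices of the list \<open>w\<close>; the vertex \<open>(i, 0)\<close> stands for the
  base vertex \<open>i\<close>, which carries \<open>w ! i - 1\<close> leaves. With weight 0 the base vertex itself is absent.
\<close>

definition pendant_graph :: "nat set set \<Rightarrow> nat list \<Rightarrow> (nat \<times> nat) graph" where
  "pendant_graph E w = Graph
     {(i, j). i < length w \<and> j < w ! i}
     (image (\<lambda>i. (i, 0)) ` E \<union> {{(i, 0), (i, j)} | i j. i < length w \<and> 0 < j \<and> j < w ! i})"

definition base_edges :: "nat list \<Rightarrow> nat set set \<Rightarrow> bool" where
  "base_edges w E \<longleftrightarrow> (\<forall>e\<in>E. card e = 2 \<and> (\<forall>i\<in>e. i < length w \<and> 0 < w ! i))"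

lemma finite_base_edges: "base_edges w E \<Longrightarrow> finite E"
  by (rule finite_subset[of _ "Pow {..<length w}"]) (auto simp: base_edges_def)

lemma star_forest_pendant: "star_forest w = pendant_graph {} w"
  by (simp add: star_forest_def pendant_graph_def)

lemma finite_pendant_verts: "finite {(i, j). i < length w \<and> j < w ! i}" for w :: "nat list"
proof (rule finite_subset)
  show "{(i, j). i < length w \<and> j < w ! i} \<subseteq> {..<length w} \<times> {..sum_list w}"
    using elem_le_sum_list[of _ w] by (auto intro: order.trans less_imp_le)
qed simp

lemma pair_card_2: "x \<noteq> y \<Longrightarrow> card {x, y} = 2"
  by simp

lemma simple_pendant_graph:
  assumes "base_edges w E" shows "simple_graph (pendant_graph E w)"
proof -
  have "card (image (\<lambda>i. (i, 0::nat)) e) = 2" if "e \<in> E" for e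
    using that assms by (subst card_image) (auto simp: base_edges_def inj_on_def)
  then show ?thesis
    using finite_pendant_verts[of w] assms
    by (auto simp: simple_graph_def pendant_graph_def base_edges_def pair_card_2)
qed

text \<open>
  Replacing \<open>v\<close> by \<open>u\<close> collapses no base edge other than \<open>uv\<close>, although it may identify
  edges with each other.
\<close>

lemma edge_contraction_base:
  assumes "base_edges w (insert {u, v} F)" "{u, v} \<notin> F" "u \<noteq> v"
  defines "r \<equiv> \<lambda>i. if i = v then u else i"
  assumes w': "length w' = length w" "\<And>i. i < length w \<Longrightarrow> 0 < w ! i \<Longrightarrow> i \<noteq> v \<Longrightarrow> 0 < w' ! i"
  shows "base_edges w' (image r ` F)"
  unfolding base_edges_def
proof (intro ballI conjI)
  fix e assume "e \<in> image r ` F"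
  then obtain d where d: "d \<in> F" "e = r ` d" by auto
  have dw: "card d = 2" "\<forall>i\<in>d. i < length w \<and> 0 < w ! i" using assms(1) d by (auto simp: base_edges_def)
  have "inj_on r d"
  proof -
    obtain a b where ab: "d = {a, b}" "a \<noteq> b" using dw by (meson card_2_iff)
    then have "\<not> (a = u \<and> b = v)" "\<not> (a = v \<and> b = u)" using d(1) assms(2) by (auto simp: insert_commute)
    then show ?thesis using ab by (auto simp: r_def inj_on_def)
  qed
  then show "card e = 2" using dw d(2) by (simp add: card_image)
  have uv: "u < length w" "0 < w ! u" using assms(1) by (auto simp: base_edges_def)
  show "i < length w'" "0 < w' ! i" if "i \<in> e" for i
    using that d(2) dw w' uv assms(3) by (auto simp: r_def split: if_splits)
qed

text \<open>
  A base vertex of degree one without leaves is itself a leaf. The weight 0 stands for a missing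
  vertex, so that the remaining positions keep their numbers.
\<close>

lemma pendant_absorb_leaf:
  assumes F: "base_edges w F" "\<forall>e\<in>F. v \<notin> e" and uv: "u < length w" "v < length w" "u \<noteq> v"
    and wv: "w ! v = 1" "0 < w ! u"
  defines "w' \<equiv> w[u := Suc (w ! u), v := 0]"
  shows "csf (pendant_graph (insert {u, v} F) w) = csf (pendant_graph F w')"
proof (rule csf_isomorphic)
  have len: "length w' = length w" by (simp add: w'_def)
  let ?f = "\<lambda>p. if p = (v, 0) then (u, w ! u) else p"
  show "simple_graph (pendant_graph (insert {u, v} F) w)"
    using assms by (intro simple_pendant_graph) (auto simp: base_edges_def pair_card_2)
  let ?V = "{(i, j). i < length w \<and> j < w ! i}" let ?V' = "{(i, j). i < length w' \<and> j < w' ! i}"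
  have nth: "w' ! i = (if i = v then 0 else if i = u then Suc (w ! u) else w ! i)" if "i < length w" for i
    using that uv by (auto simp: w'_def nth_list_update)
  show "bij_betw ?f (verts (pendant_graph (insert {u, v} F) w)) (verts (pendant_graph F w'))"
    unfolding pendant_graph_def graph.sel
  proof (rule bij_betw_byWitness[where f' = "\<lambda>p. if p = (u, w ! u) then (v, 0) else p"])
    show "\<forall>a\<in>?V. (if ?f a = (u, w ! u) then (v, 0) else ?f a) = a"
      by (auto split: if_splits)
    show "\<forall>a\<in>?V'. ?f (if a = (u, w ! u) then (v, 0) else a) = a"
      using nth len by (auto split: if_splits)
    show "?f ` ?V \<subseteq> ?V'" using nth len uv wv by (auto split: if_splits)
    show "(\<lambda>p. if p = (u, w ! u) then (v, 0) else p) ` ?V' \<subseteq> ?V"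
      using nth len uv wv by (auto split: if_splits)
  qed
  let ?L = "{{(i, 0), (i, j)} | i j. i < length w \<and> 0 < j \<and> j < w ! i}"
  let ?L' = "{{(i, 0), (i, j)} | i j. i < length w' \<and> 0 < j \<and> j < w' ! i}"
  have b: "image ?f ` image (\<lambda>i. (i, 0)) ` F = image (\<lambda>i. (i, 0)) ` F"
    unfolding image_image using F(2) by (intro image_cong refl) (auto simp: image_iff)
  have l: "image ?f ` ?L = ?L"
  proof -
    have "?f ` e = e" if "e \<in> ?L" for e using that uv wv by auto
    then show ?thesis by (auto simp: image_iff)
  qed
  have mem: "e \<in> ?L \<longleftrightarrow> (\<exists>i<length w. \<exists>j<w ! i. 0 < j \<and> e = {(i, 0), (i, j)})"
    "e \<in> ?L' \<longleftrightarrow> (\<exists>i<length w. \<exists>j<w' ! i. 0 < j \<and> e = {(i, 0), (i, j)})" for e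
    unfolding len by blast+
  have l': "?L' = insert {(u, 0), (u, w ! u)} ?L"
  proof (rule set_eqI)
    fix e
    have "(\<exists>i<length w. \<exists>j<w' ! i. 0 < j \<and> e = {(i, 0), (i, j)}) \<longleftrightarrow>
      e = {(u, 0), (u, w ! u)} \<or> (\<exists>i<length w. \<exists>j<w ! i. 0 < j \<and> e = {(i, 0), (i, j)})"
      (is "?l \<longleftrightarrow> ?r")
    proof
      assume ?l
      then obtain i j where ij: "e = {(i, 0), (i, j)}" "i < length w" "0 < j" "j < w' ! i" by blast
      show ?r
      proof (cases "j < w ! i")
        case False
        then have "i = u" "j = w ! u" using ij nth[of i] by (auto split: if_splits)
        then show ?thesis using ij by simp
      qed (use ij in blast)
    next
      assume ?r
      then consider "e = {(u, 0), (u, w ! u)}"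
        | i j where "i < length w" "j < w ! i" "0 < j" "e = {(i, 0), (i, j)}" by blast
      then show ?l
      proof cases
        case 1
        have "w ! u < w' ! u" using nth[of u] uv by simp
        then show ?thesis using 1 uv wv by blast
      next
        case (2 i j)
        then have "i \<noteq> v" using wv by auto
        then have "j < w' ! i" using 2 nth[of i] by auto
        then show ?thesis using 2 by blast
      qed
    qed
    then show "e \<in> ?L' \<longleftrightarrow> e \<in> insert {(u, 0), (u, w ! u)} ?L"
      unfolding insert_iff mem .
  qed
  show "edges (pendant_graph F w') = image ?f ` edges (pendant_graph (insert {u, v} F) w)"
    unfolding pendant_graph_def graph.sel l' image_Un image_insert b l using uv wv by auto
qed

text \<open>
  The neighbours of \<open>v\<close> in the base graph become neighbours of \<open>u\<close>, and its \<open>w ! v - 1\<close> leaves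
  become leaves of \<open>u\<close>. Then \<open>v\<close> is an isolated vertex in the second graph, and one more leaf of
  \<open>u\<close> in the third.
\<close>

lemma pendant_deletion_contraction:
  assumes F: "base_edges w (insert {u, v} F)" "{u, v} \<notin> F" "u \<noteq> v"
  defines "r \<equiv> \<lambda>i. if i = v then u else i"
  shows "csf (pendant_graph (insert {u, v} F) w) = csf (pendant_graph F w)
     - csf (pendant_graph (image r ` F) (w[u := w ! u + w ! v - 1, v := 1]))
     + csf (pendant_graph (image r ` F) (w[u := w ! u + w ! v, v := 0]))"
proof -
  define w' where "w' = w[u := w ! u + w ! v - 1, v := 1]"
  have len: "length w' = length w" by (simp add: w'_def)
  have uv: "u < length w" "v < length w" "0 < w ! u" "0 < w ! v"
    using F(1) by (auto simp: base_edges_def)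
  have nth: "w' ! i = (if i = v then 1 else if i = u then w ! u + w ! v - 1 else w ! i)" if "i < length w" for i
    using that uv by (auto simp: w'_def nth_list_update)
  have be: "base_edges w' (image r ` F)"
    unfolding r_def using nth len uv by (intro edge_contraction_base[OF F]) auto
  have bw: "base_edges w (image r ` F)"
    unfolding r_def by (intro edge_contraction_base[OF F]) auto
  have ru: "r u = u" "r v = u" by (auto simp: r_def)
  have rv: "\<forall>e\<in>image r ` F. v \<notin> e" using F(3) by (auto simp: r_def split: if_splits)
  let ?V = "{(i, j). i < length w \<and> j < w ! i}"
  let ?L = "{{(i, 0), (i, j)} | i j. i < length w \<and> 0 < j \<and> j < w ! i}"
  let ?L' = "{{(r i, 0), (i, j)} | i j. i < length w \<and> 0 < j \<and> j < w ! i}"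
  let ?B = "image (\<lambda>i. (i, 0::nat)) ` F" let ?B' = "image (\<lambda>i. (r i, 0::nat)) ` F"
  let ?V'' = "{(i, j). i < length w' \<and> j < w' ! i}"
  let ?L'' = "{{(i, 0), (i, j)} | i j. i < length w' \<and> 0 < j \<and> j < w' ! i}"
  \<comment> \<open>The leaves \<open>(v, 1), (v, 2), \<dots>\<close> are appended to those of \<open>u\<close>, which end at \<open>(u, w ! u - 1)\<close>.\<close>
  let ?f = "\<lambda>(i, j). if i = v \<and> 0 < j then (u, w ! u + j - 1) else (i, j)"
  let ?g = "\<lambda>(i, j). if i = u \<and> w ! u \<le> j then (v, j + 1 - w ! u) else (i, j)"
  have B': "?B' = image (\<lambda>i. (i, 0)) ` image r ` F" by (simp add: image_image)
  have s1: "simple_graph (Graph ?V (?B \<union> ?L))"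
    using simple_pendant_graph[of w F] F(1) by (simp add: pendant_graph_def base_edges_def)
  \<comment> \<open>The edges of the base graph and the leaf edges at \<open>v\<close> are all moved to \<open>u\<close>, on the same vertices.\<close>
  have s2: "simple_graph (Graph ?V (?B' \<union> ?L'))"
  proof -
    have "card e = 2 \<and> e \<subseteq> ?V" if e: "e \<in> ?B'" for e
    proof -
      obtain d where d: "d \<in> image r ` F" "e = (\<lambda>i. (i, 0)) ` d" using e unfolding B' by blast
      have "card d = 2" "\<forall>i\<in>d. i < length w \<and> 0 < w ! i"
        using bw d unfolding base_edges_def by blast+
      then show ?thesis using d by (auto simp: card_image inj_on_def)
    qed
    moreover have "card e = 2 \<and> e \<subseteq> ?V" if e: "e \<in> ?L'" for e
      using e uv F(3) by (auto simp: r_def pair_card_2)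
    ultimately show ?thesis using finite_pendant_verts[of w] unfolding simple_graph_def graph.sel by blast
  qed
  have dc: "csf (Graph ?V (insert {(u, 0), (v, 0)} (?B \<union> ?L))) =
    csf (Graph ?V (?B \<union> ?L)) - csf (Graph ?V (?B' \<union> ?L')) + csf (Graph ?V (insert {(u, 0), (v, 0)} (?B' \<union> ?L')))"
  proof (rule deletion_contraction[OF s1 s2])
    fix \<kappa> :: "nat \<times> nat \<Rightarrow> nat" assume k: "\<kappa> (u, 0) = \<kappa> (v, 0)"
    then have kr: "\<kappa> (r i, 0) = \<kappa> (i, 0)" for i by (simp add: r_def)
    have "inj_on \<kappa> ((\<lambda>i. (i, 0)) ` e) \<longleftrightarrow> inj_on \<kappa> ((\<lambda>i. (r i, 0)) ` e)" if e: "e \<in> F" for e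
    proof -
      have "card e = 2" using F(1) e by (simp add: base_edges_def)
      then obtain a b where ab: "e = {a, b}" "a \<noteq> b" by (meson card_2_iff)
      have "card (r ` e) = 2" using be e by (auto simp: base_edges_def)
      then have "r a \<noteq> r b" using ab by auto
      then show ?thesis using ab kr by (auto simp: inj_on_def)
    qed
    moreover have "inj_on \<kappa> {(i, 0), (i, j)} \<longleftrightarrow> inj_on \<kappa> {(r i, 0), (i, j)}" if "0 < j" for i j
      using that kr by (auto simp: inj_on_def)
    ultimately show "(\<forall>e\<in>?B \<union> ?L. inj_on \<kappa> e) \<longleftrightarrow> (\<forall>e\<in>?B' \<union> ?L'. inj_on \<kappa> e)"
      unfolding ball_Un by (intro arg_cong2[of _ _ _ _ "(\<and>)"]) (auto, blast+)
  qed (use uv F(3) in auto)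
  have bij: "bij_betw ?f ?V ?V''"
  proof (rule bij_betw_byWitness[where f' = ?g])
    show "\<forall>a\<in>?V. ?g (?f a) = a" using uv F(3) by auto
    show "\<forall>a\<in>?V''. ?f (?g a) = a" using uv F(3) nth len by auto
    show "?f ` ?V \<subseteq> ?V''" using uv F(3) nth len by (auto split: if_splits)
    show "?g ` ?V'' \<subseteq> ?V" using uv F(3) nth len by (auto split: if_splits)
  qed
  have eB: "image ?f ` ?B' = ?B'"
    unfolding image_image by (intro image_cong refl) auto
  have eL: "image ?f ` ?L' = ?L''"
  proof safe
    fix i j assume ij: "i < length w" "0 < j" "j < w ! i"
    show "\<exists>i' j'. ?f ` {(r i, 0), (i, j)} = {(i', 0), (i', j')} \<and> i' < length w' \<and> 0 < j' \<and> j' < w' ! i'"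
    proof (cases "i = v")
      case True
      then show ?thesis using ij uv F(3) len nth[of u] ru
        by (intro exI[of _ u] exI[of _ "w ! u + j - 1"]) auto
    next
      case False
      then show ?thesis using ij uv len nth[of i]
        by (intro exI[of _ i] exI[of _ j]) (auto simp: r_def)
    qed
  next
    fix i j assume ij: "i < length w'" "0 < j" "j < w' ! i"
    then have iv: "i \<noteq> v" using len nth[of i] by auto
    show "{(i, 0), (i, j)} \<in> image ?f ` ?L'"
    proof (cases "i = u \<and> w ! u \<le> j")
      case True
      have "{(r v, 0), (v, j + 1 - w ! u)} \<in> ?L'"
        using True ij uv F(3) nth[of u] by (intro CollectI exI[of _ v] exI[of _ "j + 1 - w ! u"]) auto
      moreover have "?f ` {(r v, 0), (v, j + 1 - w ! u)} = {(i, 0), (i, j)}"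
        using True ij uv F(3) ru by auto
      ultimately show ?thesis by (metis (no_types, lifting) image_eqI)
    next
      case False
      have "{(r i, 0), (i, j)} \<in> ?L'"
        using False ij iv nth[of i] len by (intro CollectI exI[of _ i] exI[of _ j]) (auto split: if_splits)
      moreover have "?f ` {(r i, 0), (i, j)} = {(i, 0), (i, j)}"
        using iv by (auto simp: r_def)
      ultimately show ?thesis by (metis (no_types, lifting) image_eqI)
    qed
  qed
  have i1: "csf (Graph ?V (?B' \<union> ?L')) = csf (pendant_graph (image r ` F) w')"
    by (rule csf_isomorphic[OF s2, of ?f])
      (use bij eB eL B' in \<open>simp_all add: pendant_graph_def image_Un\<close>)
  have s3: "simple_graph (Graph ?V (insert {(u, 0), (v, 0)} (?B' \<union> ?L')))"
    using s2 uv F(3) by (auto simp: simple_graph_def pair_card_2)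
  have i2: "csf (Graph ?V (insert {(u, 0), (v, 0)} (?B' \<union> ?L'))) =
    csf (pendant_graph (insert {u, v} (image r ` F)) w')"
    by (rule csf_isomorphic[OF s3, of ?f])
      (use bij eB eL B' in \<open>simp_all add: pendant_graph_def image_Un\<close>)
  also have "\<dots> = csf (pendant_graph (image r ` F) (w'[u := Suc (w' ! u), v := 0]))"
    using be rv uv F(3) nth len by (intro pendant_absorb_leaf) auto
  also have "w'[u := Suc (w' ! u), v := 0] = w[u := w ! u + w ! v, v := 0]"
    using uv F(3) by (auto intro!: nth_equalityI simp: w'_def nth_list_update)
  finally show ?thesis
    using dc i1 by (simp add: pendant_graph_def w'_def)
qed

section \<open>Expansion in star forests\<close>

definition num_stars :: "nat list \<Rightarrow> nat" where
  "num_stars w = length (filter (\<lambda>x. 0 < x) w)"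

definition num_proper_stars :: "nat list \<Rightarrow> nat" where
  "num_proper_stars w = length (filter (\<lambda>x. 1 < x) w)"

text \<open>
  Star forests on \<open>n\<close> vertices that are lexicographically below \<open>(k, j)\<close>: the filtration of the
  leading-term arguments. With \<open>j = 0\<close> it bounds just the number of stars.
\<close>

definition star_span :: "nat \<Rightarrow> nat \<Rightarrow> nat \<Rightarrow> series set" where
  "star_span n k j = series.span {star_csf w | w. sum_list w = n \<and>
     (num_stars w < k \<or> num_stars w = k \<and> num_proper_stars w < j)}"

lemma star_csf_mset:
  assumes "mset xs = mset ys"
  shows "star_csf xs = star_csf ys"
proof -
  obtain p where p: "p permutes {..<length ys}" "permute_list p ys = xs"
    using mset_eq_permutation[OF assms] by metis
  have len: "length xs = length ys" using assms mset_eq_length by blast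
  have nth: "xs ! i = ys ! p i" if "i < length ys" for i
    using p that by (auto simp: permute_list_nth)
  have pi: "p i < length ys \<longleftrightarrow> i < length ys" for i
    using permutes_in_image[OF p(1), of i] by simp
  have inv: "inv p i < length ys \<longleftrightarrow> i < length ys" for i
    using permutes_in_image[OF permutes_inv[OF p(1)], of i] by simp
  have pinv: "p (inv p i) = i" "inv p (p i) = i" for i
    using permutes_inverses[OF p(1)] by auto
  let ?f = "\<lambda>(i, j). (p i, j)"
  have "csf (star_forest xs) = csf (star_forest ys)"
  proof (rule csf_isomorphic[where f = ?f])
    show "simple_graph (star_forest xs)"
      unfolding star_forest_pendant by (rule simple_pendant_graph) (simp add: base_edges_def)
    show "bij_betw ?f (verts (star_forest xs)) (verts (star_forest ys))"
      by (rule bij_betw_byWitness[where f' = "\<lambda>(i, j). (inv p i, j)"])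
        (auto simp: star_forest_def len pi inv pinv nth)
    have "edges (star_forest ys) = {{(p i, 0), (p i, j)} | i j. p i < length ys \<and> 0 < j \<and> j < ys ! p i}"
    proof -
      have "(\<exists>i. Q i) \<longleftrightarrow> (\<exists>i. Q (p i))" for Q by (metis pinv(1))
      from this[of "\<lambda>i. \<exists>j. e = {(i, 0), (i, j)} \<and> i < length ys \<and> 0 < j \<and> j < ys ! i" for e]
      show ?thesis unfolding star_forest_def graph.sel by (rule Collect_cong)
    qed
    also have "\<dots> = {?f ` {(i, 0), (i, j)} | i j. i < length xs \<and> 0 < j \<and> j < xs ! i}"
      by (intro Collect_cong ex_cong1) (auto simp: nth len pi)
    also have "\<dots> = image ?f ` edges (star_forest xs)"
      unfolding star_forest_def graph.sel by blast
    finally show "edges (star_forest ys) = image ?f ` edges (star_forest xs)" .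
  qed
  then show ?thesis by (simp add: star_csf_def)
qed

lemma star_csf_append_zeros: "star_csf (xs @ replicate k 0) = star_csf xs"
proof -
  have eq: "i < length (xs @ replicate k 0) \<and> j < (xs @ replicate k 0) ! i \<longleftrightarrow> i < length xs \<and> j < xs ! i" for i j
    by (auto simp: nth_append split: if_splits)
  then have "star_forest (xs @ replicate k 0) = star_forest xs"
  proof -
    have "{(i, j). i < length (xs @ replicate k 0) \<and> j < (xs @ replicate k 0) ! i} = {(i, j). i < length xs \<and> j < xs ! i}"
      by (simp only: eq)
    moreover have "{{(i, 0), (i, j)} |i j. i < length (xs @ replicate k 0) \<and> 0 < j \<and> j < (xs @ replicate k 0) ! i}
      = {{(i, 0), (i, j)} |i j. i < length xs \<and> 0 < j \<and> j < xs ! i}"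
      by (intro Collect_cong ex_cong1) (metis eq)
    ultimately show ?thesis by (simp only: star_forest_def)
  qed
  then show ?thesis by (simp add: star_csf_def)
qed

text \<open>
  Stars may be permuted, and stars of size 0 dropped. This absorbs all rearrangements and all zeros
  that deletion and contraction leave behind.
\<close>

lemma star_csf_cong:
  assumes "mset (filter (\<lambda>x. 0 < x) w) = mset (filter (\<lambda>x. 0 < x) w')"
  shows "star_csf w = star_csf w'"
proof -
  have "star_csf w = star_csf (filter (\<lambda>x. 0 < x) w)" for w :: "nat list"
  proof -
    have "mset w = mset (filter (\<lambda>x. 0 < x) w @ replicate (length (filter (\<lambda>x. \<not> 0 < x) w)) 0)"
    proof -
      have "filter (\<lambda>x. \<not> 0 < x) w = replicate (length (filter (\<lambda>x. \<not> 0 < x) w)) 0"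
        by (rule replicate_length_same[symmetric]) auto
      then have "mset (filter (\<lambda>x. \<not> 0 < x) w) = mset (replicate (length (filter (\<lambda>x. \<not> 0 < x) w)) 0)"
        by metis
      then show ?thesis
        by (metis mset_append mset_filter multiset_partition)
    qed
    from star_csf_mset[OF this] show ?thesis by (simp only: star_csf_append_zeros)
  qed
  then show ?thesis using star_csf_mset[OF assms] by metis
qed

definition partition_of :: "nat list \<Rightarrow> nat list" where
  "partition_of w = rev (sort (filter (\<lambda>x. 0 < x) w))"

lemma mset_partition_of: "mset (partition_of w) = filter_mset (\<lambda>x. 0 < x) (mset w)"
  by (simp add: partition_of_def)

lemma star_csf_partition_of: "star_csf (partition_of w) = star_csf w"
  by (rule star_csf_cong) (simp add: mset_partition_of filter_filter_mset)

lemma partition_of_in_partitions: "partition_of w \<in> partitions (sum_list w)"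
proof -
  have "sum_list (partition_of w) = sum_list (filter (\<lambda>x. 0 < x) w)"
    unfolding partition_of_def sum_list_rev
    by (metis mset_sort sum_mset_sum_list)
  also have "\<dots> = sum_list w" by (induction w) auto
  finally show ?thesis
    by (auto simp: partitions_def partition_of_def sorted_wrt_rev)
qed

lemma num_partition_of:
  "length (partition_of w) = num_stars w"
  "num_proper_stars (partition_of w) = num_proper_stars w"
proof -
  show "length (partition_of w) = num_stars w"
    by (simp add: partition_of_def num_stars_def)
  have "size (filter_mset (\<lambda>x. 1 < x) (mset (partition_of w))) = size (filter_mset (\<lambda>x. 1 < x) (mset w))"
    unfolding mset_partition_of filter_filter_mset by (intro arg_cong[where f = size] filter_mset_cong) auto
  then show "num_proper_stars (partition_of w) = num_proper_stars w"
    by (metis num_proper_stars_def mset_filter size_mset)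
qed

lemma length_filter_sum_list: "length (filter P w) = sum_list (map (\<lambda>x. of_bool (P x)) w)"
  by (induction w) auto

lemma sum_list_update2:
  fixes f :: "'a \<Rightarrow> nat"
  assumes "u < length w" "v < length w" "u \<noteq> v"
  shows "sum_list (map f (w[u := x, v := y])) + f (w ! u) + f (w ! v) = sum_list (map f w) + f x + f y"
proof -
  have 1: "sum_list (map f (w[i := x])) + f (w ! i) = sum_list (map f w) + f x" if "i < length w" for i x and w :: "'a list"
  proof -
    have "sum_list (map f w) \<ge> f (w ! i)" using that elem_le_sum_list[of i "map f w"] by simp
    then show ?thesis using that by (simp add: map_update sum_list_update)
  qed
  show ?thesis using 1[of u w x] 1[of v "w[u := x]" y] assms by simp
qed

text \<open>
  The effect of the two contracted terms on the quantities that govern all inductions below.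
\<close>

lemma merge_counts:
  assumes "u < length w" "v < length w" "u \<noteq> v" "0 < w ! u" "0 < w ! v"
  shows "sum_list (w[u := w ! u + w ! v - 1, v := 1]) = sum_list w"
    "sum_list (w[u := w ! u + w ! v, v := 0]) = sum_list w"
    "num_stars (w[u := w ! u + w ! v - 1, v := 1]) = num_stars w"
    "Suc (num_stars (w[u := w ! u + w ! v, v := 0])) = num_stars w"
    "1 < w ! u \<Longrightarrow> 1 < w ! v \<Longrightarrow> Suc (num_proper_stars (w[u := w ! u + w ! v - 1, v := 1])) = num_proper_stars w"
proof -
  note upd = sum_list_update2[OF assms(1-3)]
  show "sum_list (w[u := w ! u + w ! v - 1, v := 1]) = sum_list w"
    using upd[of "\<lambda>x. x" "w ! u + w ! v - 1" 1] assms by simp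
  show "sum_list (w[u := w ! u + w ! v, v := 0]) = sum_list w"
    using upd[of "\<lambda>x. x" "w ! u + w ! v" 0] by simp
  show "num_stars (w[u := w ! u + w ! v - 1, v := 1]) = num_stars w"
    using upd[of "\<lambda>x. of_bool (0 < x)" "w ! u + w ! v - 1" 1] assms
    by (simp add: num_stars_def length_filter_sum_list)
  show "Suc (num_stars (w[u := w ! u + w ! v, v := 0])) = num_stars w"
    using upd[of "\<lambda>x. of_bool (0 < x)" "w ! u + w ! v" 0] assms
    by (simp add: num_stars_def length_filter_sum_list)
  show "Suc (num_proper_stars (w[u := w ! u + w ! v - 1, v := 1])) = num_proper_stars w"
    if "1 < w ! u" "1 < w ! v"
    using upd[of "\<lambda>x. of_bool (1 < x)" "w ! u + w ! v - 1" 1] that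
    by (simp add: num_proper_stars_def length_filter_sum_list less_diff_conv)
qed

lemma star_csf_in_star_span:
  "sum_list w = n \<Longrightarrow> num_stars w < k \<or> num_stars w = k \<and> num_proper_stars w < j \<Longrightarrow> star_csf w \<in> star_span n k j"
  unfolding star_span_def by (rule series.span_base) auto

lemma star_span_mono:
  "k < k' \<or> k = k' \<and> j \<le> j' \<Longrightarrow> f \<in> star_span n k j \<Longrightarrow> f \<in> star_span n k' j'"
  unfolding star_span_def by (erule rev_subsetD, rule series.span_mono) auto

lemma star_span_add: "f \<in> star_span n k j \<Longrightarrow> g \<in> star_span n k j \<Longrightarrow> f + g \<in> star_span n k j"
  and star_span_diff: "f \<in> star_span n k j \<Longrightarrow> g \<in> star_span n k j \<Longrightarrow> f - g \<in> star_span n k j"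
  and star_span_scale: "f \<in> star_span n k j \<Longrightarrow> qscale c f \<in> star_span n k j"
  and star_span_zero: "0 \<in> star_span n k j"
  unfolding star_span_def
  by (auto intro: series.span_add series.span_diff series.span_scale series.span_zero)

text \<open>
  Each term of the deletion-contraction relation has fewer base edges and no more stars.
\<close>

lemma pendant_graph_in_star_span:
  assumes "base_edges w E"
  shows "csf (pendant_graph E w) \<in> star_span (sum_list w) (Suc (num_stars w)) 0"
  using assms
proof (induction "card E" arbitrary: E w rule: less_induct)
  case less
  show ?case
  proof (cases "E = {}")
    case True
    have "star_csf w \<in> star_span (sum_list w) (Suc (num_stars w)) 0"
      by (rule star_csf_in_star_span) auto
    with True show ?thesis by (simp add: star_csf_def star_forest_pendant)
  next
    case False
    then obtain e where e: "e \<in> E" by auto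
    then have "card e = 2" using less.prems by (auto simp: base_edges_def)
    then obtain u v where uv: "e = {u, v}" "u \<noteq> v" by (meson card_2_iff)
    define F where "F = E - {e}"
    have F: "E = insert {u, v} F" "{u, v} \<notin> F" using e uv by (auto simp: F_def)
    have fin: "finite F" using finite_base_edges[OF less.prems] by (simp add: F_def)
    have card: "card F < card E" using F fin by simp
    define r where "r = (\<lambda>i. if i = v then u else i)"
    have card': "card (image r ` F) < card E" using card card_image_le[OF fin, of "image r"] by simp
    have b: "base_edges w (insert {u, v} F)" using less.prems F by simp
    have w: "u < length w" "v < length w" "0 < w ! u" "0 < w ! v" using b by (auto simp: base_edges_def)
    note mc = merge_counts[OF w(1,2) uv(2) w(3,4)]
    let ?w1 = "w[u := w ! u + w ! v - 1, v := 1]" and ?w2 = "w[u := w ! u + w ! v, v := 0]"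
    have b1: "base_edges ?w1 (image r ` F)" "base_edges ?w2 (image r ` F)"
      unfolding r_def using w by (intro edge_contraction_base[OF b F(2) uv(2)]; auto simp: nth_list_update)+
    have "csf (pendant_graph F w) \<in> star_span (sum_list w) (Suc (num_stars w)) 0"
      using b by (intro less.hyps card) (auto simp: base_edges_def)
    moreover have "csf (pendant_graph (image r ` F) ?w1) \<in> star_span (sum_list w) (Suc (num_stars w)) 0"
      using less.hyps[OF card' b1(1)] mc by simp
    moreover have "csf (pendant_graph (image r ` F) ?w2) \<in> star_span (sum_list w) (Suc (num_stars w)) 0"
      by (rule star_span_mono[OF _ less.hyps[OF card' b1(2), unfolded mc(2)]]) (use mc in simp)
    ultimately show ?thesis
      unfolding F(1) pendant_deletion_contraction[OF b F(2) uv(2), folded r_def]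
      by (intro star_span_add star_span_diff)
  qed
qed

text \<open>
  Any graph is a base graph without pendant leaves.
\<close>

lemma csf_in_span_stars:
  fixes G :: "'a graph"
  assumes G: "simple_graph G"
  shows "csf G \<in> series.span (star_csf ` partitions (card (verts G)))"
proof -
  define n where "n = card (verts G)"
  have fin: "finite (verts G)" using G by (simp add: simple_graph_def)
  then obtain h where h: "bij_betw h {..<n} (verts G)"
    using ex_bij_betw_nat_finite[OF fin] by (auto simp: n_def atLeast0LessThan)
  define g where "g = inv_into {..<n} h"
  have g: "g x < n" "h (g x) = x" if "x \<in> verts G" for x
    using that h bij_betw_inv_into_right[OF h] bij_betw_apply[OF bij_betw_inv_into[OF h]] by (auto simp: g_def)
  let ?w = "replicate n (1::nat)" let ?E = "image g ` edges G"
  have ed: "e \<subseteq> verts G" "card e = 2" if "e \<in> edges G" for e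
    using G that by (auto simp: simple_graph_def)
  have "card (g ` e) = 2" if "e \<in> edges G" for e
    using ed[OF that] g(2) by (subst card_image) (auto intro: inj_on_inverseI[where g = h])
  then have b: "base_edges ?w ?E" using ed g by (fastforce simp: base_edges_def)
  have "csf (pendant_graph ?E ?w) = csf G"
  proof (rule csf_isomorphic[OF simple_pendant_graph[OF b], where f = "h \<circ> fst"])
    have v: "verts (pendant_graph ?E ?w) = (\<lambda>i. (i, 0)) ` {..<n}"
      by (auto simp: pendant_graph_def)
    show "bij_betw (h \<circ> fst) (verts (pendant_graph ?E ?w)) (verts G)"
      unfolding v using h by (auto simp: bij_betw_def inj_on_def image_image)
    have E: "edges (pendant_graph ?E ?w) = (\<lambda>e. (\<lambda>i. (i, 0::nat)) ` g ` e) ` edges G"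
      by (auto simp: pendant_graph_def image_image)
    have "image (h \<circ> fst) ` edges (pendant_graph ?E ?w) = (\<lambda>e. (h \<circ> fst) ` (\<lambda>i. (i, 0::nat)) ` g ` e) ` edges G"
      unfolding E by (rule image_image)
    also have "\<dots> = (\<lambda>e. e) ` edges G"
    proof (rule image_cong[OF refl])
      fix e assume "e \<in> edges G"
      then show "(h \<circ> fst) ` (\<lambda>i. (i, 0::nat)) ` g ` e = e"
        using ed(1) g(2) by (force simp: image_image)
    qed
    finally show "edges G = image (h \<circ> fst) ` edges (pendant_graph ?E ?w)" by simp
  qed
  with pendant_graph_in_star_span[OF b] have "csf G \<in> star_span n (Suc (num_stars ?w)) 0" by (simp add: sum_list_replicate)
  moreover have "star_span n k j \<subseteq> series.span (star_csf ` partitions n)" for k j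
    unfolding star_span_def
  proof (rule series.span_mono, clarify)
    fix w :: "nat list"
    show "star_csf w \<in> star_csf ` partitions (sum_list w)"
      by (rule image_eqI[where x = "partition_of w"])
        (simp_all add: star_csf_partition_of partition_of_in_partitions)
  qed
  ultimately show ?thesis unfolding n_def by blast
qed

section \<open>Linear independence of the star basis\<close>

definition multipartite :: "nat list \<Rightarrow> (nat \<times> nat) graph" where
  "multipartite p = Graph {(i, j). i < length p \<and> j < p ! i}
     {{(i, j), (i', j')} | i j i' j'. i < length p \<and> j < p ! i \<and> i' < length p \<and> j' < p ! i' \<and> i \<noteq> i'}"

definition exponents :: "nat multiset \<Rightarrow> nat multiset" where
  "exponents m = image_mset (count m) (mset_set (set_mset m))"

definition monomial_of :: "nat list \<Rightarrow> nat multiset" where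
  "monomial_of p = (\<Sum>i<length p. replicate_mset (p ! i) (Suc i))"

lemma partition_nth_pos: "p \<in> partitions n \<Longrightarrow> i < length p \<Longrightarrow> 0 < p ! i"
  by (auto simp: partitions_def dest!: nth_mem)

text \<open>
  A monomial determines the partition from which it was formed.
\<close>

lemma exponents_sum:
  assumes "inj_on c {..<length p}" "\<And>i. i < length p \<Longrightarrow> 0 < p ! i"
  shows "exponents (\<Sum>i<length p. replicate_mset (p ! i) (c i)) = mset p"
    "set_mset (\<Sum>i<length p. replicate_mset (p ! i) (c i)) = c ` {..<length p}"
proof -
  let ?m = "\<Sum>i<length p. replicate_mset (p ! i) (c i)"
  have cnt: "count ?m (c k) = p ! k" if "k < length p" for k
  proof -
    have "count ?m (c k) = (\<Sum>i<length p. if i = k then p ! k else 0)"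
      unfolding count_sum using assms(1) that by (intro sum.cong) (auto simp: inj_on_def)
    then show ?thesis using that by simp
  qed
  show set: "set_mset ?m = c ` {..<length p}"
    using assms(2) by (auto simp: set_mset_sum split: if_splits)
  have "exponents ?m = image_mset (\<lambda>k. count ?m (c k)) (mset_set {..<length p})"
    unfolding exponents_def set using assms(1)
    by (simp add: image_mset_mset_set[symmetric] multiset.map_comp comp_def)
  also have "\<dots> = image_mset (\<lambda>k. p ! k) (mset_set {..<length p})"
    using cnt by (intro image_mset_cong) auto
  also have "\<dots> = mset p"
    by (metis lessThan_atLeast0 map_nth mset_map mset_upt)
  finally show "exponents ?m = mset p" .
qed

lemma image_mset_pairs:
  fixes p :: "nat list"
  shows "image_mset \<kappa> (mset_set {(i, j). i < length p \<and> j < p ! i}) =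
    (\<Sum>i<length p. image_mset (\<lambda>j. \<kappa> (i, j)) (mset_set {..<p ! i}))"
proof -
  have "image_mset \<kappa> (mset_set A) = (\<Sum>a\<in>A. {#\<kappa> a#})" if "finite A" for A and \<kappa> :: "'b \<Rightarrow> 'a"
    using that by (induction A) auto
  note this[simp]
  have "{(i, j). i < length p \<and> j < p ! i} = (SIGMA i:{..<length p}. {..<p ! i})" by auto
  then show ?thesis using finite_pendant_verts[of p] by (simp add: sum.Sigma)
qed

lemma simple_multipartite: "simple_graph (multipartite p)"
  using finite_pendant_verts[of p] by (auto simp: simple_graph_def multipartite_def pair_card_2)

lemma csf_multipartite_nonzero:
  assumes "p \<in> partitions n"
  shows "csf (multipartite p) (monomial_of p) \<noteq> 0"
proof -
  let ?V = "{(i, j). i < length p \<and> j < p ! i}"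
  let ?k = "restrict (\<lambda>(i, j). Suc i) ?V"
  have "image_mset ?k (mset_set ?V) = image_mset (\<lambda>(i, j). Suc i) (mset_set ?V)"
    using finite_pendant_verts[of p] by (intro image_mset_cong) auto
  also have "\<dots> = monomial_of p"
    unfolding image_mset_pairs by (simp add: monomial_of_def image_mset_const_eq)
  finally have "colouring_monomial (multipartite p) ?k = monomial_of p"
    by (simp add: colouring_monomial_def multipartite_def)
  moreover have "?k \<in> proper_colourings (multipartite p)"
    by (auto simp: proper_colourings_def multipartite_def doubleton_eq_iff)
  ultimately have "?k \<in> {\<kappa> \<in> proper_colourings (multipartite p). colouring_monomial (multipartite p) \<kappa> = monomial_of p}"
    by simp
  moreover have "finite {\<kappa> \<in> proper_colourings (multipartite p). colouring_monomial (multipartite p) \<kappa> = monomial_of p}"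
    by (rule finite_colourings_with_monomial) (use simple_multipartite[of p] in \<open>simp add: simple_graph_def\<close>)
  ultimately show ?thesis by (auto simp: csf_def)
qed

lemma partition_eqI: "p \<in> partitions n \<Longrightarrow> q \<in> partitions n \<Longrightarrow> mset p = mset q \<Longrightarrow> p = q"
proof -
  assume "p \<in> partitions n" "q \<in> partitions n" "mset p = mset q"
  then have "sorted (rev p)" "sorted (rev q)" "mset (rev p) = mset (rev q)"
    by (auto simp: partitions_def sorted_wrt_rev)
  then have "rev p = rev q" by (metis properties_for_sort)
  then show "p = q" by simp
qed

text \<open>
  A colour occurs in at most one part, so choosing a colour of each part is injective. If there
  are no other colours, each part is monochromatic and the multiplicities of the colours are the sizes
  of the parts.
\<close>

lemma csf_multipartite_triangular:
  assumes p: "p \<in> partitions n" and q: "q \<in> partitions n"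
    and nz: "csf (multipartite p) (monomial_of q) \<noteq> 0"
  shows "length p < length q \<or> p = q"
proof -
  have mq: "exponents (monomial_of q) = mset q" "set_mset (monomial_of q) = Suc ` {..<length q}"
    unfolding monomial_of_def using exponents_sum[of Suc q] partition_nth_pos[OF q] by auto
  have "{\<kappa> \<in> proper_colourings (multipartite p). colouring_monomial (multipartite p) \<kappa> = monomial_of q} \<noteq> {}"
  proof
    assume e: "{\<kappa> \<in> proper_colourings (multipartite p). colouring_monomial (multipartite p) \<kappa> = monomial_of q} = {}"
    show False using nz unfolding csf_def e by simp
  qed
  then obtain \<kappa> where k: "\<kappa> \<in> proper_colourings (multipartite p)" "colouring_monomial (multipartite p) \<kappa> = monomial_of q"
    by blast
  let ?V = "{(i, j). i < length p \<and> j < p ! i}"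
  define c where "c i = \<kappa> (i, 0)" for i
  have ne: "\<kappa> (i, j) \<noteq> \<kappa> (i', j')" if "i < length p" "j < p ! i" "i' < length p" "j' < p ! i'" "i \<noteq> i'" for i j i' j'
  proof -
    have "{(i, j), (i', j')} \<in> edges (multipartite p)"
      using that unfolding multipartite_def graph.sel by blast
    then show ?thesis using k(1) unfolding proper_colourings_def by blast
  qed
  have m: "image_mset \<kappa> (mset_set ?V) = monomial_of q"
    using k(2) by (simp add: colouring_monomial_def multipartite_def)
  have kV: "\<kappa> ` ?V = Suc ` {..<length q}"
    using finite_pendant_verts[of p] unfolding mq(2)[symmetric] m[symmetric] by simp
  have inj: "inj_on c {..<length p}"
  proof (rule inj_onI)
    fix i i' assume "i \<in> {..<length p}" "i' \<in> {..<length p}" "c i = c i'"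
    then show "i = i'" using ne[of i 0 i' 0] partition_nth_pos[OF p] by (auto simp: c_def)
  qed
  have sub: "c ` {..<length p} \<subseteq> Suc ` {..<length q}"
    unfolding kV[symmetric] using partition_nth_pos[OF p] by (auto simp: c_def)
  have cc: "card (c ` {..<length p}) = length p" "card (Suc ` {..<length q}) = length q"
    using inj by (auto simp: card_image)
  show ?thesis
  proof (cases "length p = length q")
    case True
    then have eq: "c ` {..<length p} = Suc ` {..<length q}"
      using card_subset_eq[OF _ sub] cc by auto
    have kc: "\<kappa> (i, j) = c i" if "i < length p" "j < p ! i" for i j
    proof -
      have "\<kappa> (i, j) \<in> c ` {..<length p}" unfolding eq kV[symmetric] using that by auto
      then obtain i' where "i' < length p" "\<kappa> (i, j) = \<kappa> (i', 0)" by (auto simp: c_def)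
      then show ?thesis using ne[of i j i' 0] that partition_nth_pos[OF p] by (auto simp: c_def)
    qed
    have "image_mset \<kappa> (mset_set ?V) = (\<Sum>i<length p. replicate_mset (p ! i) (c i))"
      unfolding image_mset_pairs
    proof (rule sum.cong)
      fix i assume "i \<in> {..<length p}"
      then have "image_mset (\<lambda>j. \<kappa> (i, j)) (mset_set {..<p ! i}) = image_mset (\<lambda>j. c i) (mset_set {..<p ! i})"
        using kc by (intro image_mset_cong) auto
      then show "image_mset (\<lambda>j. \<kappa> (i, j)) (mset_set {..<p ! i}) = replicate_mset (p ! i) (c i)"
        by (simp add: image_mset_const_eq)
    qed simp
    then have "mset p = mset q"
      using exponents_sum(1)[of c p] inj partition_nth_pos[OF p] m mq(1) by simp
    then show ?thesis using partition_eqI[OF p q] by blast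
  next
    case False
    have "length p \<le> length q" using card_mono[OF _ sub] cc by simp
    with False show ?thesis by simp
  qed
qed

lemma sum_series_apply: "(\<Sum>a\<in>A. g a) m = (\<Sum>a\<in>A. g a m)" for g :: "'a \<Rightarrow> series"
  by (induction A rule: infinite_finite_induct) auto

text \<open>
  In a vanishing combination, look at the coefficient of \<open>m b\<close> for an index \<open>b\<close> of least rank
  that occurs.
\<close>

lemma triangular_independent:
  fixes f :: "'a \<Rightarrow> series" and m :: "'a \<Rightarrow> nat multiset" and r :: "'a \<Rightarrow> nat"
  assumes fin: "finite A"
    and nz: "\<And>a. a \<in> A \<Longrightarrow> f a (m a) \<noteq> 0"
    and tri: "\<And>a b. a \<in> A \<Longrightarrow> b \<in> A \<Longrightarrow> f a (m b) \<noteq> 0 \<Longrightarrow> r a < r b \<or> a = b"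
  shows "inj_on f A" "series.independent (f ` A)"
proof -
  show inj: "inj_on f A"
  proof (rule inj_onI)
    fix a b assume "a \<in> A" "b \<in> A" "f a = f b"
    then show "a = b" using nz[of a] nz[of b] tri[of a b] tri[of b a] by auto
  qed
  have "\<forall>a\<in>A. c a = 0" if z: "(\<Sum>a\<in>A. qscale (c a) (f a)) = 0" for c
  proof (rule ccontr)
    assume "\<not> (\<forall>a\<in>A. c a = 0)"
    then obtain b where b: "b \<in> A" "c b \<noteq> 0" and min: "\<And>a. a \<in> A \<Longrightarrow> c a \<noteq> 0 \<Longrightarrow> r b \<le> r a"
      using ex_min_if_finite[of "r ` {a \<in> A. c a \<noteq> 0}"] fin by (auto simp: not_less)
    have "0 = (\<Sum>a\<in>A. c a * f a (m b))"
      using fun_cong[OF z, of "m b"] by (simp add: sum_series_apply qscale_def)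
    also have "\<dots> = (\<Sum>a\<in>A. if a = b then c b * f b (m b) else 0)"
      using tri[OF _ b(1)] min by (intro sum.cong) (force simp: not_less)+
    also have "\<dots> = c b * f b (m b)" using b fin by simp
    finally show False using b nz[of b] by simp
  qed
  then show "series.independent (f ` A)"
    unfolding series.dependent_finite[OF finite_imageI[OF fin]] using inj
    by (auto simp: sum.reindex comp_def) (metis comp_apply)
qed

text \<open>
  A spanning set with no more elements than some independent set contains no redundant element.
\<close>

lemma spanning_card_le_independent:
  assumes "finite T" "series.independent X" "X \<subseteq> series.span T" "card T \<le> card X"
  shows "series.independent T"
proof -
  obtain B where B: "B \<subseteq> T" "series.independent B" "T \<subseteq> series.span B"
    by (rule series.maximal_independent_subset)
  have "X \<subseteq> series.span B"
    using assms(3) B(3) series.span_minimal[OF B(3) series.subspace_span] by blast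
  then have "card X \<le> card B"
    using series.independent_span_bound[OF finite_subset[OF B(1) assms(1)] assms(2)] by blast
  then have "B = T" using B(1) assms(1,4) by (intro card_seteq) auto
  then show ?thesis using B(2) by simp
qed

text \<open>
  The multipartite functions are independent elements of the span of the \<open>star_csf p\<close>, and there is
  one of each for every partition. Therefore the \<open>star_csf p\<close> are pairwise distinct and independent.
\<close>

lemma star_csf_basis:
  "inj_on star_csf (partitions n)" "series.independent (star_csf ` partitions n)"
proof -
  have size: "card (verts (multipartite p)) = n" if "p \<in> partitions n" for p
  proof -
    have "verts (multipartite p) = (SIGMA i:{..<length p}. {..<p ! i})" by (auto simp: multipartite_def)
    then show ?thesis using that by (simp add: partitions_def sum_list_sum_nth lessThan_atLeast0)
  qed
  let ?f = "\<lambda>p. csf (multipartite p)"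
  have ind: "inj_on ?f (partitions n)" "series.independent (?f ` partitions n)"
    using triangular_independent[OF finite_partitions, of n ?f monomial_of length]
      csf_multipartite_nonzero[of _ n] csf_multipartite_triangular[of _ n] by blast+
  have sub: "?f ` partitions n \<subseteq> series.span (star_csf ` partitions n)"
    using csf_in_span_stars[OF simple_multipartite] size by auto
  have c: "card (?f ` partitions n) = card (partitions n)" using ind(1) by (rule card_image)
  have le: "card (star_csf ` partitions n) \<le> card (partitions n)"
    by (intro card_image_le finite_partitions)
  show "series.independent (star_csf ` partitions n)"
    by (rule spanning_card_le_independent[OF _ ind(2) sub]) (use c le finite_partitions in auto)
  have "card (partitions n) \<le> card (star_csf ` partitions n)"
    using series.independent_span_bound[OF _ ind(2) sub] finite_partitions c by auto
  then show "inj_on star_csf (partitions n)"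
    using le by (intro eq_card_imp_inj_on finite_partitions) auto
qed

section \<open>Stars joined along a path or a cycle\<close>

definition path_edges :: "nat \<Rightarrow> nat set set" where
  "path_edges k = {{i, Suc i} | i. Suc i < k}"

text \<open>
  For \<open>k = 2\<close> this is the path on two vertices, as the double edge counts once. This makes it a
  suitable base case for the recursion on cycles.
\<close>

definition cycle_edges :: "nat \<Rightarrow> nat set set" where
  "cycle_edges k = insert {0, k - 1} (path_edges k)"

lemma path_edges_Suc: "path_edges (Suc (Suc k)) = insert {k, Suc k} (path_edges (Suc k))"
  unfolding path_edges_def by (auto simp: less_Suc_eq)

lemma path_edges_le_1: "k \<le> 1 \<Longrightarrow> path_edges k = {}"
  by (auto simp: path_edges_def)

lemma path_edges_bound: "e \<in> path_edges k \<Longrightarrow> i \<in> e \<Longrightarrow> i < k"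
  by (auto simp: path_edges_def)

lemma base_path_edges:
  "k \<le> length w \<Longrightarrow> (\<And>i. i < k \<Longrightarrow> 0 < w ! i) \<Longrightarrow> base_edges w (path_edges k)"
  by (auto simp: base_edges_def path_edges_def)

lemma base_cycle_edges:
  "2 \<le> k \<Longrightarrow> k \<le> length w \<Longrightarrow> (\<And>i. i < k \<Longrightarrow> 0 < w ! i) \<Longrightarrow> base_edges w (cycle_edges k)"
  using base_path_edges[of k w] by (auto simp: base_edges_def cycle_edges_def pair_card_2)

definition path_csf :: "nat \<Rightarrow> nat list \<Rightarrow> series" where
  "path_csf k w = csf (pendant_graph (path_edges k) w)"

definition cycle_csf :: "nat \<Rightarrow> nat list \<Rightarrow> series" where
  "cycle_csf k w = csf (pendant_graph (cycle_edges k) w)"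

lemma path_csf_1: "path_csf (Suc 0) w = star_csf w"
  by (simp add: path_csf_def path_edges_le_1 star_csf_def star_forest_pendant)

lemma path_csf_in_star_span:
  assumes "k \<le> length w" "\<And>i. i < k \<Longrightarrow> 0 < w ! i"
  shows "path_csf k w \<in> star_span (sum_list w) (Suc (num_stars w)) 0"
  unfolding path_csf_def by (rule pendant_graph_in_star_span[OF base_path_edges[OF assms]])

text \<open>
  Deletion-contraction at the last path edge keeps the shape: all three terms are again stars
  joined along an initial segment of the list.
\<close>

lemma path_csf_step:
  assumes "Suc k < length w" "\<And>i. i \<le> Suc k \<Longrightarrow> 0 < w ! i"
  shows "path_csf (Suc (Suc k)) w = path_csf (Suc k) w
    - path_csf (Suc k) (w[k := w ! k + w ! Suc k - 1, Suc k := 1])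
    + path_csf (Suc k) (w[k := w ! k + w ! Suc k, Suc k := 0])"
proof -
  let ?r = "\<lambda>i. if i = Suc k then k else i"
  have "?r ` e = e" if "e \<in> path_edges (Suc k)" for e
  proof -
    have "?r ` e = (\<lambda>i. i) ` e" using path_edges_bound[OF that] by (intro image_cong) auto
    then show ?thesis by simp
  qed
  then have r: "image ?r ` path_edges (Suc k) = path_edges (Suc k)" by simp
  have b: "base_edges w (insert {k, Suc k} (path_edges (Suc k)))"
    unfolding path_edges_Suc[symmetric] using assms by (intro base_path_edges) auto
  have "{k, Suc k} \<notin> path_edges (Suc k)"
    using path_edges_bound[of "{k, Suc k}" "Suc k" "Suc k"] by auto
  from pendant_deletion_contraction[OF b this, unfolded r] show ?thesis
    by (simp add: path_csf_def path_edges_Suc)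
qed

text \<open>
  When the last star is a single vertex, cutting it off by deletion and by near-contraction gives the
  same graph, and these two terms cancel.
\<close>

lemma path_csf_end_1:
  assumes "Suc k < length w" "\<And>i. i \<le> Suc k \<Longrightarrow> 0 < w ! i" "w ! Suc k = 1"
  shows "path_csf (Suc (Suc k)) w = path_csf (Suc k) (w[k := Suc (w ! k), Suc k := 0])"
proof -
  have "w[k := w ! k + w ! Suc k - 1, Suc k := 1] = w"
    using assms(3) by (metis add_diff_cancel_right' list_update_id)
  then show ?thesis using path_csf_step[OF assms(1,2)] assms(3) by simp
qed

lemma path_csf_end_1_in_star_span:
  assumes "Suc k < length w" "\<And>i. i \<le> Suc k \<Longrightarrow> 0 < w ! i" "w ! Suc k = 1"
  shows "path_csf (Suc (Suc k)) w \<in> star_span (sum_list w) (num_stars w) 0"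
proof -
  let ?w = "w[k := Suc (w ! k), Suc k := 0]"
  have "sum_list ?w = sum_list w" "Suc (num_stars ?w) = num_stars w"
    using merge_counts(2,4)[of k w "Suc k"] assms by auto
  moreover have "path_csf (Suc k) ?w \<in> star_span (sum_list ?w) (Suc (num_stars ?w)) 0"
    using assms by (intro path_csf_in_star_span) (auto simp: nth_list_update)
  moreover have "path_csf (Suc (Suc k)) w = path_csf (Suc k) ?w" by (rule path_csf_end_1[OF assms])
  ultimately show ?thesis by metis
qed

lemma path_csf_contract_in_star_span:
  assumes "Suc k < length w" "\<And>i. i \<le> Suc k \<Longrightarrow> 0 < w ! i"
  shows "path_csf (Suc k) (w[k := w ! k + w ! Suc k, Suc k := 0]) \<in> star_span (sum_list w) (num_stars w) 0"
proof -
  let ?w = "w[k := w ! k + w ! Suc k, Suc k := 0]"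
  have "path_csf (Suc k) ?w \<in> star_span (sum_list ?w) (Suc (num_stars ?w)) 0"
    using assms by (intro path_csf_in_star_span) (auto simp: nth_list_update)
  then show ?thesis using merge_counts(2,4)[of k w "Suc k"] assms by auto
qed

text \<open>
  After the last edge is deleted, the path ends in a single vertex, which costs one star. What
  remains to leading order is the term in which that vertex is cut off.
\<close>

lemma path_csf_swap_1:
  assumes "\<forall>x\<in>set \<gamma>. 0 < x" "\<gamma> \<noteq> []" "0 < b"
  shows "path_csf (length \<gamma> + 2) (\<gamma> @ [1, b] @ \<beta>) + path_csf (length \<gamma> + 1) (\<gamma> @ [b, 1] @ \<beta>)
    \<in> star_span (sum_list (\<gamma> @ [1, b] @ \<beta>)) (num_stars (\<gamma> @ [1, b] @ \<beta>)) 0"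
proof -
  let ?w = "\<gamma> @ [1, b] @ \<beta>" and ?k = "length \<gamma>"
  obtain k where k: "?k = Suc k" using assms(2) by (cases \<gamma>) auto
  have pos: "0 < ?w ! i" if "i \<le> Suc ?k" for i
    using that assms by (auto simp: nth_append nth_Cons split: nat.splits)
  have len: "Suc ?k < length ?w" by simp
  have upd: "?w[?k := ?w ! ?k + ?w ! Suc ?k - 1, Suc ?k := 1] = \<gamma> @ [b, 1] @ \<beta>"
    by (simp add: list_update_append nth_append)
  have "path_csf (Suc ?k) ?w \<in> star_span (sum_list ?w) (num_stars ?w) 0"
    unfolding k
  proof (rule path_csf_end_1_in_star_span)
    show "?w ! Suc k = 1" unfolding k[symmetric] by (simp add: nth_append)
    show "0 < ?w ! i" if "i \<le> Suc k" for i using pos[of i] that k by linarith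
    show "Suc k < length ?w" unfolding k[symmetric] by simp
  qed
  from star_span_add[OF this path_csf_contract_in_star_span[OF len pos]]
  show ?thesis using path_csf_step[OF len pos, unfolded upd] by simp
qed

text \<open>
  Each of the \<open>m\<close> single vertices before the last star is cut off from the spine, at the cost of a
  sign.
\<close>

lemma path_csf_move_ones:
  assumes "\<forall>x\<in>set \<gamma>. 0 < x" "\<gamma> \<noteq> []" "0 < b"
  shows "path_csf (length \<gamma> + m + 1) (\<gamma> @ replicate m 1 @ [b] @ \<beta>)
      - qscale ((-1) ^ m) (path_csf (length \<gamma> + 1) (\<gamma> @ [b] @ replicate m 1 @ \<beta>))
    \<in> star_span (sum_list \<gamma> + m + b + sum_list \<beta>) (num_stars (\<gamma> @ [b] @ \<beta>) + m) 0"
proof (induction m arbitrary: \<beta>)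
  case 0
  show ?case using star_span_zero[unfolded zero_fun_def] by (simp add: qscale_def)
next
  case (Suc m)
  let ?S = "star_span (sum_list \<gamma> + Suc m + b + sum_list \<beta>) (num_stars (\<gamma> @ [b] @ \<beta>) + Suc m) 0"
  let ?A = "path_csf (length \<gamma> + Suc m + 1) (\<gamma> @ replicate (Suc m) 1 @ [b] @ \<beta>)"
  let ?B = "path_csf (length \<gamma> + m + 1) (\<gamma> @ replicate m 1 @ [b] @ [1] @ \<beta>)"
  let ?C = "path_csf (length \<gamma> + 1) (\<gamma> @ [b] @ replicate (Suc m) 1 @ \<beta>)"
  have r: "replicate (Suc m) (1::nat) @ xs = replicate m 1 @ [1] @ xs" for xs
    by (simp add: replicate_app_Cons_same)
  have "?A + ?B \<in> ?S"
  proof -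
    let ?w = "(\<gamma> @ replicate m 1) @ [1, b] @ \<beta>"
    have "sum_list ?w = sum_list \<gamma> + Suc m + b + sum_list \<beta>"
      "num_stars ?w = num_stars (\<gamma> @ [b] @ \<beta>) + Suc m"
      by (simp_all add: num_stars_def sum_list_replicate)
    moreover have "path_csf (length (\<gamma> @ replicate m 1) + 2) ?w
      + path_csf (length (\<gamma> @ replicate m 1) + 1) ((\<gamma> @ replicate m 1) @ [b, 1] @ \<beta>)
      \<in> star_span (sum_list ?w) (num_stars ?w) 0"
      by (rule path_csf_swap_1) (use assms in auto)
    ultimately show ?thesis unfolding r by (simp add: add_ac)
  qed
  moreover have "?B - qscale ((-1) ^ m) ?C \<in> ?S"
  proof -
    have "sum_list \<gamma> + m + b + sum_list ([1] @ \<beta>) = sum_list \<gamma> + Suc m + b + sum_list \<beta>"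
      "num_stars (\<gamma> @ [b] @ [1] @ \<beta>) + m = num_stars (\<gamma> @ [b] @ \<beta>) + Suc m"
      by (simp_all add: num_stars_def)
    with Suc.IH[of "[1] @ \<beta>"] show ?thesis unfolding r by (simp only:)
  qed
  ultimately have "(?A + ?B) - (?B - qscale ((-1) ^ m) ?C) \<in> ?S" by (rule star_span_diff)
  moreover have "(?A + ?B) - (?B - qscale ((-1) ^ m) ?C) = ?A - qscale ((-1) ^ Suc m) ?C"
    by (simp add: fun_eq_iff qscale_def)
  ultimately show ?case by (simp only:)
qed

text \<open>
  If both stars at the last edge are proper, the near-contracted term has one proper star less.
  The contracted one has one star less. So only deletion contributes to the leading term.
\<close>

lemma path_csf_leading:
  assumes "k < length w" "\<And>i. i \<le> k \<Longrightarrow> 1 < w ! i"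
  shows "path_csf (Suc k) w - star_csf w \<in> star_span (sum_list w) (num_stars w) (num_proper_stars w)"
  using assms
proof (induction k arbitrary: w)
  case 0
  then show ?case using star_span_zero[unfolded zero_fun_def] by (simp add: path_csf_1)
next
  case (Suc k)
  let ?S = "star_span (sum_list w) (num_stars w) (num_proper_stars w)"
  let ?v = "w[k := w ! k + w ! Suc k - 1, Suc k := 1]" and ?u = "w[k := w ! k + w ! Suc k, Suc k := 0]"
  have gt: "1 < w ! k" "1 < w ! Suc k" and len: "k < length w" "Suc k < length w"
    using Suc.prems by auto
  have pos: "0 < w ! i" if "i \<le> Suc k" for i using Suc.prems(2)[OF that] by simp
  have "0 < w ! k" "0 < w ! Suc k" using pos by auto
  note mc = merge_counts[OF len n_not_Suc_n this]
  have 1: "path_csf (Suc k) w - star_csf w \<in> ?S"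
    using Suc.prems by (intro Suc.IH) auto
  have 2: "path_csf (Suc k) ?v - star_csf ?v \<in> ?S"
  proof -
    have "path_csf (Suc k) ?v - star_csf ?v \<in> star_span (sum_list ?v) (num_stars ?v) (num_proper_stars ?v)"
    proof (rule Suc.IH)
      have "1 < w ! k + w ! Suc k - 1" using gt by linarith
      then show "1 < ?v ! i" if "i \<le> k" for i
        using Suc.prems(2)[of i] that len by (cases "i = k") (simp_all add: nth_list_update)
    qed (use len in simp)
    then show ?thesis using mc gt by (auto intro: star_span_mono[rotated])
  qed
  have 3: "star_csf ?v \<in> ?S"
    using mc gt by (intro star_csf_in_star_span) auto
  have 4: "path_csf (Suc k) ?u \<in> ?S"
    by (rule star_span_mono[OF _ path_csf_contract_in_star_span[OF len(2) pos]]) auto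
  have "path_csf (Suc (Suc k)) w - star_csf w = (path_csf (Suc k) w - star_csf w)
      - (path_csf (Suc k) ?v - star_csf ?v) - star_csf ?v + path_csf (Suc k) ?u"
    using path_csf_step[OF len(2) pos] by (simp add: algebra_simps)
  then show ?case
    using star_span_add[OF star_span_diff[OF star_span_diff[OF 1 2] 3] 4] by (simp only:)
qed

lemma cycle_csf_2: "cycle_csf 2 w = path_csf 2 w"
  by (simp add: cycle_csf_def path_csf_def cycle_edges_def path_edges_Suc numeral_2_eq_2 path_edges_le_1)

text \<open>
  The cycle is opened at the edge between its last vertex and vertex 0. As the last vertex has weight 1, the weights do not change in the middle term.
\<close>

lemma cycle_csf_step:
  assumes "Suc (Suc k) < length w" "\<And>i. i \<le> Suc (Suc k) \<Longrightarrow> 0 < w ! i" "w ! Suc (Suc k) = 1"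
  shows "cycle_csf (Suc (Suc (Suc k))) w = path_csf (Suc (Suc (Suc k))) w - cycle_csf (Suc (Suc k)) w
    + cycle_csf (Suc (Suc k)) (w[0 := Suc (w ! 0), Suc (Suc k) := 0])"
proof -
  let ?n = "Suc (Suc k)"
  let ?r = "\<lambda>i. if i = ?n then 0 else i"
  have "?r ` e = e" if "e \<in> path_edges ?n" for e
  proof -
    have "?r ` e = (\<lambda>i. i) ` e" using path_edges_bound[OF that] by (intro image_cong) auto
    then show ?thesis by simp
  qed
  then have r: "image ?r ` path_edges (Suc ?n) = cycle_edges ?n"
    unfolding path_edges_Suc[of "Suc k"] cycle_edges_def by (auto simp: insert_commute)
  have c: "cycle_edges (Suc ?n) = insert {0, ?n} (path_edges (Suc ?n))"
    by (simp add: cycle_edges_def)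
  have b: "base_edges w (insert {0, ?n} (path_edges (Suc ?n)))"
    unfolding c[symmetric] using assms by (intro base_cycle_edges) auto
  have "{0, ?n} \<notin> path_edges (Suc ?n)"
    by (auto simp: path_edges_def doubleton_eq_iff)
  moreover have "w[0 := w ! 0 + w ! ?n - 1, ?n := 1] = w"
    using assms(3) by (metis add_diff_cancel_right' list_update_id)
  ultimately show ?thesis
    using pendant_deletion_contraction[OF b, unfolded r] assms(3)
    by (simp add: cycle_csf_def path_csf_def c)
qed

text \<open>
  Deletion-contraction in general only keeps the number of stars from growing. Here every term of the
  recursion loses a star, since the paths end in a single vertex.
\<close>

lemma cycle_csf_in_star_span:
  assumes "Suc (Suc k) \<le> length w" "\<And>i. i \<le> Suc k \<Longrightarrow> 0 < w ! i" "\<And>i. 0 < i \<Longrightarrow> i \<le> Suc k \<Longrightarrow> w ! i = 1"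
  shows "cycle_csf (Suc (Suc k)) w \<in> star_span (sum_list w) (num_stars w) 0"
  using assms
proof (induction k arbitrary: w)
  case 0
  have "path_csf (Suc (Suc 0)) w \<in> star_span (sum_list w) (num_stars w) 0"
    using 0 by (intro path_csf_end_1_in_star_span) auto
  then show ?case using cycle_csf_2[of w] by (simp add: numeral_2_eq_2)
next
  case (Suc k)
  let ?n = "Suc (Suc k)" let ?u = "w[0 := Suc (w ! 0), ?n := 0]"
  have len: "?n < length w" and pos: "\<And>i. i \<le> ?n \<Longrightarrow> 0 < w ! i" and one: "w ! ?n = 1"
    using Suc.prems by auto
  have w0: "0 < length w" using len by linarith
  have u: "sum_list ?u = sum_list w" "Suc (num_stars ?u) = num_stars w"
    using merge_counts(2,4)[OF w0 len, unfolded one] pos[of 0] by simp_all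
  have "path_csf (Suc ?n) w \<in> star_span (sum_list w) (num_stars w) 0"
    by (rule path_csf_end_1_in_star_span[OF len pos one])
  moreover have "cycle_csf ?n w \<in> star_span (sum_list w) (num_stars w) 0"
    using Suc.prems by (intro Suc.IH) auto
  moreover have "cycle_csf ?n ?u \<in> star_span (sum_list w) (num_stars w) 0"
  proof -
    have "cycle_csf ?n ?u \<in> star_span (sum_list ?u) (num_stars ?u) 0"
    proof (rule Suc.IH)
      show "0 < ?u ! i" if "i \<le> Suc k" for i
        using pos[of i] len w0 that by (cases "i = 0") (simp_all add: nth_list_update)
      show "?u ! i = 1" if "0 < i" "i \<le> Suc k" for i
        using Suc.prems(3)[of i] that by simp
    qed (use len in simp)
    then show ?thesis using u by (auto intro: star_span_mono[rotated])
  qed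
  moreover have "cycle_csf (Suc ?n) w = path_csf (Suc ?n) w - cycle_csf ?n w + cycle_csf ?n ?u"
    by (rule cycle_csf_step) (use len pos one in auto)
  ultimately show ?case by (simp only: star_span_add star_span_diff)
qed

section \<open>Caterpillars and cuttlefish modulo shorter star forests\<close>

lemma caterpillar_pendant: "caterpillar \<alpha> = pendant_graph (path_edges (length \<alpha>)) \<alpha>"
proof -
  have "{{(i, 0), (Suc i, 0)} | i. Suc i < length \<alpha>} = image (\<lambda>i. (i, 0::nat)) ` path_edges (length \<alpha>)"
    by (simp add: path_edges_def setcompr_eq_image image_image)
  then show ?thesis by (simp add: caterpillar_def pendant_graph_def)
qed

lemma csf_caterpillar: "csf (caterpillar \<alpha>) = path_csf (length \<alpha>) \<alpha>"
  by (simp add: caterpillar_pendant path_csf_def)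

lemma path_csf_2_leading:
  assumes "0 < a" "0 < b"
  shows "path_csf 2 ([a, b] @ \<beta>) - (star_csf ([a, b] @ \<beta>) - star_csf ([a + b - 1, 1] @ \<beta>))
    \<in> star_span (a + b + sum_list \<beta>) (num_stars \<beta> + 2) 0"
proof -
  let ?w = "[a, b] @ \<beta>"
  have pos: "0 < ?w ! i" if "i \<le> Suc 0" for i using that assms by (cases i) auto
  have len: "Suc 0 < length ?w" by simp
  have "num_stars ?w = num_stars \<beta> + 2" using assms by (simp add: num_stars_def)
  then show ?thesis
    using path_csf_step[OF len pos] path_csf_contract_in_star_span[OF len pos]
    by (simp add: path_csf_1 numeral_2_eq_2 add_ac)
qed

text \<open>
  A caterpillar whose spine has only single vertices between its two ends has at most two terms with the
  maximal number of stars; the second is a hook if \<open>\<beta>\<close> consists of ones.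
\<close>

lemma two_part_caterpillar:
  assumes "0 < a" "0 < b"
  shows "path_csf (m + 2) ([a] @ replicate m 1 @ [b] @ \<beta>)
      - qscale ((-1) ^ m) (star_csf ([a, b] @ replicate m 1 @ \<beta>) - star_csf ([a + b - 1, 1] @ replicate m 1 @ \<beta>))
    \<in> star_span (a + b + m + sum_list \<beta>) (num_stars \<beta> + m + 2) 0"
proof -
  let ?d = "star_csf ([a, b] @ replicate m 1 @ \<beta>) - star_csf ([a + b - 1, 1] @ replicate m 1 @ \<beta>)"
  let ?P = "path_csf 2 ([a, b] @ replicate m 1 @ \<beta>)"
  let ?S = "star_span (a + b + m + sum_list \<beta>) (num_stars \<beta> + m + 2) 0"
  have "num_stars ([a, b] @ \<beta>) = num_stars \<beta> + 2" "num_stars (replicate m 1 @ \<beta>) = num_stars \<beta> + m"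
    using assms by (simp_all add: num_stars_def)
  then have 1: "path_csf (m + 2) ([a] @ replicate m 1 @ [b] @ \<beta>) - qscale ((-1) ^ m) ?P \<in> ?S"
    and 2: "?P - ?d \<in> ?S"
    using path_csf_move_ones[of "[a]" b m \<beta>] path_csf_2_leading[of a b "replicate m 1 @ \<beta>"] assms
    by (simp_all add: numeral_2_eq_2 sum_list_replicate add_ac)
  have "path_csf (m + 2) ([a] @ replicate m 1 @ [b] @ \<beta>) - qscale ((-1) ^ m) ?d =
    (path_csf (m + 2) ([a] @ replicate m 1 @ [b] @ \<beta>) - qscale ((-1) ^ m) ?P) + qscale ((-1) ^ m) (?P - ?d)"
    by (simp add: fun_eq_iff qscale_def algebra_simps)
  then show ?thesis using star_span_add[OF 1 star_span_scale[OF 2]] by (simp only:)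
qed

text \<open>
  Since \<open>p\<close> is decreasing, its parts 1 come last, and rotating puts them in a single run just before
  the largest part. The run is moved out of the spine, and the remaining spine has only proper stars.
\<close>

lemma caterpillar_leading:
  assumes p: "p \<in> partitions n" and l: "2 \<le> length p" "2 \<le> p ! 1"
  obtains c where "c \<noteq> 0"
    "csf (caterpillar (rotate1 p)) - qscale c (star_csf p) \<in> star_span n (length p) (num_proper_stars p)"
proof -
  obtain x q where pq: "p = x # q" "q \<noteq> []" using l(1) by (cases p; cases "tl p") auto
  define \<gamma> where "\<gamma> = takeWhile (\<lambda>y. 1 < y) q"
  define m where "m = length (dropWhile (\<lambda>y. 1 < y) q)"
  have srt: "sorted_wrt (\<ge>) q" "\<forall>y\<in>set q. y \<le> x \<and> 1 \<le> y" and sum: "x + sum_list q = n"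
    using p pq by (auto simp: partitions_def)
  have "y = 1" if y: "y \<in> set (dropWhile (\<lambda>y. 1 < y) q)" for y
  proof -
    obtain z zs where z: "dropWhile (\<lambda>y. 1 < y) q = z # zs"
      using y by (metis empty_iff list.set(1) neq_Nil_conv)
    have "sorted_wrt (\<ge>) (z # zs)" using sorted_wrt_dropWhile[OF srt(1)] z by metis
    moreover have "\<not> 1 < z" using hd_dropWhile[of "\<lambda>y. 1 < y" q] unfolding z by simp
    moreover have "y \<in> set (z # zs)" using y unfolding z .
    ultimately have "y \<le> 1" by auto
    then show ?thesis using srt(2) set_dropWhileD[OF y] by force
  qed
  then have "dropWhile (\<lambda>y. 1 < y) q = replicate m 1"
    unfolding m_def by (intro replicate_length_same[symmetric]) auto
  then have q: "q = \<gamma> @ replicate m 1" unfolding \<gamma>_def by (metis takeWhile_dropWhile_id)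
  have \<gamma>: "\<forall>y\<in>set \<gamma>. 1 < y" unfolding \<gamma>_def by (auto dest: set_takeWhileD)
  have "1 < hd q" using l(2) pq by (cases q) auto
  then have \<gamma>0: "\<gamma> \<noteq> []" unfolding \<gamma>_def using pq(2) by (cases q) auto
  have x: "1 < x" using srt(2) \<open>1 < hd q\<close> hd_in_set[OF pq(2)] by fastforce
  let ?v = "\<gamma> @ [x] @ replicate m 1"
  let ?C = "path_csf (length \<gamma> + m + 1) (\<gamma> @ replicate m 1 @ [x])" and ?P = "path_csf (length \<gamma> + 1) ?v"
  have ms: "mset ?v = mset p" by (simp add: pq q)
  have v: "sum_list ?v = n" "num_stars ?v = length p" "num_proper_stars ?v = num_proper_stars p"
  proof -
    show "sum_list ?v = n" using sum by (simp add: q)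
    have "filter (\<lambda>y. 0 < y) ?v = ?v" by (rule filter_True) (use \<gamma> x in fastforce)
    then show "num_stars ?v = length p" by (simp add: num_stars_def pq q)
    show "num_proper_stars ?v = num_proper_stars p"
      by (simp add: num_proper_stars_def pq q)
  qed
  have \<gamma>pos: "\<forall>y\<in>set \<gamma>. 0 < y" and xpos: "0 < x" using \<gamma> x by (auto dest: less_trans[OF zero_less_one])
  have 1: "?C - qscale ((-1) ^ m) ?P \<in> star_span n (length p) (num_proper_stars p)"
  proof -
    have "sum_list \<gamma> + m + x + sum_list [] = n" "num_stars (\<gamma> @ [x] @ []) + m = length p"
      using v(1,2) xpos by (simp_all add: num_stars_def sum_list_replicate)
    then have "?C - qscale ((-1) ^ m) ?P \<in> star_span n (length p) 0"
      using path_csf_move_ones[OF \<gamma>pos \<gamma>0 xpos, of m "[]"] by (simp only: append_Nil2)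
    then show ?thesis by (rule star_span_mono[rotated]) auto
  qed
  have 2: "?P - star_csf p \<in> star_span n (length p) (num_proper_stars p)"
  proof -
    have "path_csf (Suc (length \<gamma>)) ?v - star_csf ?v \<in> star_span (sum_list ?v) (num_stars ?v) (num_proper_stars ?v)"
    proof (rule path_csf_leading)
      show "1 < ?v ! i" if "i \<le> length \<gamma>" for i
      proof (cases "i < length \<gamma>")
        case True
        then show ?thesis using \<gamma> by (simp add: nth_append)
      next
        case False
        then show ?thesis using that x by (simp add: nth_append)
      qed
    qed simp
    then show ?thesis unfolding v star_csf_mset[OF ms] by simp
  qed
  have "?C - qscale ((-1) ^ m) (star_csf p) = (?C - qscale ((-1) ^ m) ?P) + qscale ((-1) ^ m) (?P - star_csf p)"
    by (simp add: fun_eq_iff qscale_def algebra_simps)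
  then have "?C - qscale ((-1) ^ m) (star_csf p) \<in> star_span n (length p) (num_proper_stars p)"
    using star_span_add[OF 1 star_span_scale[OF 2]] by (simp only:)
  moreover have "csf (caterpillar (rotate1 p)) = ?C"
    unfolding csf_caterpillar by (simp add: pq q)
  ultimately show thesis by (intro that[of "(-1) ^ m"]) auto
qed

lemma nth_hook_pos: "i \<le> k \<Longrightarrow> 0 < (Suc l # replicate k 1) ! i"
  by (cases i) auto

text \<open>
  The last vertex of the path becomes a leaf of its neighbour, so that only single vertices lie between
  the two ends of the remaining spine. The 0 in \<open>\<beta>\<close> marks the position of the absorbed vertex.
\<close>

lemma path_csf_hook:
  assumes "3 \<le> c" "c \<le> N"
  shows "path_csf c (Suc l # replicate (N - 1) 1)
      - qscale ((-1) ^ (c - 1)) (star_csf (Suc l # 2 # replicate (N - 3) 1) - star_csf (Suc (Suc l) # replicate (N - 2) 1))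
    \<in> star_span (l + N) (N - 1) 0"
proof -
  obtain m where m: "c = m + 3" using assms(1) by (metis add.commute le_Suc_ex)
  obtain r where r: "N = m + r + 3" using assms(2) m by (metis add.assoc add.commute le_Suc_ex)
  let ?w = "Suc l # replicate (N - 1) 1" let ?\<beta> = "0 # replicate r 1"
  let ?v = "[Suc l] @ replicate m 1 @ [2] @ ?\<beta>"
  have w: "?w = [Suc l] @ replicate m 1 @ [1, 1] @ replicate r 1"
    unfolding r by (simp add: replicate_add[symmetric] replicate_app_Cons_same)
  have nth: "?w ! Suc (Suc m) = 1" unfolding w by (simp add: nth_append)
  have "path_csf (Suc (Suc (Suc m))) ?w = path_csf (Suc (Suc m)) (?w[Suc m := Suc (?w ! Suc m), Suc (Suc m) := 0])"
  proof (rule path_csf_end_1)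
    show "0 < ?w ! i" if "i \<le> Suc (Suc m)" for i
      using that by (intro nth_hook_pos) (simp add: r)
  qed (use nth in \<open>auto simp: r\<close>)
  also have "?w[Suc m := Suc (?w ! Suc m), Suc (Suc m) := 0] = ?v"
    unfolding w by (simp add: list_update_append nth_append)
  finally have P: "path_csf c ?w = path_csf (m + 2) ?v" by (simp add: m eval_nat_numeral)
  have "star_csf ([Suc l, 2] @ replicate m 1 @ ?\<beta>) = star_csf (Suc l # 2 # replicate (N - 3) 1)"
    "star_csf ([Suc l + 2 - 1, 1] @ replicate m 1 @ ?\<beta>) = star_csf (Suc (Suc l) # replicate (N - 2) 1)"
    by (rule star_csf_cong; simp add: r replicate_add eval_nat_numeral)+
  moreover have "Suc l + 2 + m + sum_list ?\<beta> = l + N" "num_stars ?\<beta> + m + 2 = N - 1"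
    by (simp_all add: r num_stars_def sum_list_replicate)
  moreover have "(-1) ^ (c - 1) = (-1 :: rat) ^ m" by (simp add: m)
  ultimately show ?thesis
    using two_part_caterpillar[of "Suc l" 2 m ?\<beta>, OF zero_less_Suc zero_less_numeral]
    unfolding P by (simp only:)
qed

text \<open>
  Opening the cycle repeatedly gives an alternating sum of paths on 2 to \<open>c\<close> vertices. Up to the common
  sign \<open>(-1) ^ c\<close>, the path on 2 vertices contributes \<open>h\<close>, and each of the others contributes \<open>- d\<close>.
\<close>

lemma cycle_csf_hook:
  fixes c N l :: nat
  assumes "2 \<le> c" "c \<le> N"
  defines "h \<equiv> star_csf (Suc (Suc l) # replicate (N - 2) 1)"
  defines "d \<equiv> star_csf (Suc l # 2 # replicate (N - 3) 1) - h"
  shows "cycle_csf c (Suc l # replicate (N - 1) 1) - qscale ((-1) ^ c) (h - qscale (of_nat (c - 2)) d)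
    \<in> star_span (l + N) (N - 1) 0"
  using assms(1,2)
proof (induction c rule: dec_induct)
  case base
  obtain r where r: "N = r + 2" using base by (metis add.commute le_Suc_ex)
  let ?w = "Suc l # replicate (N - 1) 1"
  have "path_csf (Suc (Suc 0)) ?w = path_csf (Suc 0) (?w[0 := Suc (?w ! 0), Suc 0 := 0])"
  proof (rule path_csf_end_1)
    show "0 < ?w ! i" if "i \<le> Suc 0" for i using that by (cases i) (auto simp: r)
  qed (auto simp: r)
  also have "\<dots> = h"
    unfolding path_csf_1 h_def by (rule star_csf_cong) (simp add: r)
  finally have "cycle_csf 2 ?w = h" unfolding cycle_csf_2 by (simp add: numeral_2_eq_2)
  then show ?case using star_span_zero[unfolded zero_fun_def] by (simp add: qscale_def)
next
  case (step c)
  let ?w = "Suc l # replicate (N - 1) 1" let ?S = "star_span (l + N) (N - 1) 0"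
  obtain k where k: "c = Suc (Suc k)" using step.hyps by (metis add_2_eq_Suc le_Suc_ex)
  have len: "Suc (Suc k) < length ?w" and one: "?w ! Suc (Suc k) = 1"
    using step.prems by (auto simp: k)
  have pos: "0 < ?w ! i" if "i \<le> Suc (Suc k)" for i
    using that step.prems by (intro nth_hook_pos) (simp add: k)
  let ?u = "?w[0 := Suc (?w ! 0), Suc (Suc k) := 0]"
  have w0: "0 < length ?w" by simp
  have u: "sum_list ?u = l + N" "num_stars ?u = N - 1"
    using merge_counts(2,4)[OF w0 len, unfolded one] step.prems
    by (simp_all add: num_stars_def sum_list_replicate k)
  have 1: "cycle_csf (Suc (Suc k)) ?u \<in> ?S"
  proof -
    have "cycle_csf (Suc (Suc k)) ?u \<in> star_span (sum_list ?u) (num_stars ?u) 0"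
    proof (rule cycle_csf_in_star_span)
      show "0 < ?u ! i" if "i \<le> Suc k" for i
        using pos[of i] len that by (cases "i = 0") (simp_all add: nth_list_update)
      show "?u ! i = 1" if "0 < i" "i \<le> Suc k" for i
        using that step.prems by (cases i) (auto simp: k nth_list_update)
    qed (use len in simp)
    then show ?thesis by (simp only: u)
  qed
  have 2: "path_csf (Suc c) ?w - qscale ((-1) ^ c) d \<in> ?S"
    using path_csf_hook[of "Suc c" N l] step by (simp add: d_def h_def)
  have 3: "cycle_csf c ?w - qscale ((-1) ^ c) (h - qscale (of_nat (c - 2)) d) \<in> ?S"
    by (rule step.IH) (use step.prems in simp)
  have "cycle_csf (Suc c) ?w - qscale ((-1) ^ Suc c) (h - qscale (of_nat (Suc c - 2)) d) =
    (path_csf (Suc c) ?w - qscale ((-1) ^ c) d)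
     - (cycle_csf c ?w - qscale ((-1) ^ c) (h - qscale (of_nat (c - 2)) d)) + cycle_csf (Suc (Suc k)) ?u"
    using cycle_csf_step[OF len pos one]
    by (simp add: k fun_eq_iff qscale_def algebra_simps)
  then show ?case using star_span_add[OF star_span_diff[OF 2 3] 1] by (simp only:)
qed

text \<open>
  The graph is a cycle of stars of which only the one at position 0 is proper.
\<close>

lemma csf_cuttlefish:
  assumes "3 \<le> c"
  shows "csf (cuttlefish c l) = cycle_csf c (Suc l # replicate (c - 1) 1)"
proof -
  let ?w = "Suc l # replicate (c - 1) 1"
  let ?f = "\<lambda>(i, j). if j = 0 then i else c + j - 1"
  have len: "length ?w = c" using assms by simp
  have nth: "?w ! i = (if i = 0 then Suc l else 1)" if "i < c" for i
    using that by (cases i) auto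
  have b: "base_edges ?w (cycle_edges c)"
    using assms len nth by (intro base_cycle_edges) auto
  let ?V = "{(i, j). i < length ?w \<and> j < ?w ! i}"
  have V: "?V = (\<lambda>i. (i, 0)) ` {..<c} \<union> Pair 0 ` {1..l}"
  proof -
    have "(i, j) \<in> ?V \<longleftrightarrow> (i, j) \<in> (\<lambda>i. (i, 0)) ` {..<c} \<union> Pair 0 ` {1..l}" for i j
      unfolding len using nth[of i] assms by (cases "i = 0"; cases "j = 0") auto
    then show ?thesis by auto
  qed
  have L: "{{(i, 0), (i, j)} | i j. i < length ?w \<and> 0 < j \<and> j < ?w ! i} = {{(0, 0), (0, Suc j)} | j. j < l}"
  proof -
    have eq: "i < length ?w \<and> 0 < j \<and> j < ?w ! i \<longleftrightarrow> i = 0 \<and> 0 < j \<and> j \<le> l" for i j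
      unfolding len using nth[of i] assms by (cases "i = 0") auto
    have "{{(i, 0), (i, j)} | i j. i < length ?w \<and> 0 < j \<and> j < ?w ! i} = {{(0, 0), (0, j)} | j. 0 < j \<and> j \<le> l}"
      by (rule Collect_cong, simp only: eq) simp
    also have "\<dots> = {{(0, 0), (0, Suc j)} | j. j < l}"
    proof -
      have "{j. 0 < j \<and> j \<le> l} = Suc ` {j. j < l}"
      proof (rule set_eqI)
        show "j \<in> {j. 0 < j \<and> j \<le> l} \<longleftrightarrow> j \<in> Suc ` {j. j < l}" for j by (cases j) auto
      qed
      then show ?thesis by (simp add: setcompr_eq_image image_image)
    qed
    finally show ?thesis .
  qed
  have C: "{{i, Suc i mod c} | i. i < c} = cycle_edges c"
  proof -
    obtain k where k: "c = Suc k" using assms by (cases c) auto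
    have "{{i, Suc i mod c} | i. i < c} = {{i, Suc i mod c} | i. i < k} \<union> {{k, Suc k mod c}}"
    proof -
      have "{f i | i. i < Suc k} = {f i | i. i < k} \<union> {f k}" for f :: "nat \<Rightarrow> nat set"
        unfolding less_Suc_eq by blast
      from this[of "\<lambda>i. {i, Suc i mod c}"] show ?thesis unfolding k .
    qed
    also have "{{i, Suc i mod c} | i. i < k} = {{i, Suc i} | i. i < k}"
      by (intro Collect_cong ex_cong1) (auto simp: k)
    finally show ?thesis by (simp add: cycle_edges_def path_edges_def k insert_commute)
  qed
  have "csf (pendant_graph (cycle_edges c) ?w) = csf (cuttlefish c l)"
  proof (rule csf_isomorphic[OF simple_pendant_graph[OF b], of ?f])
    show "bij_betw ?f (verts (pendant_graph (cycle_edges c) ?w)) (verts (cuttlefish c l))"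
      unfolding pendant_graph_def cuttlefish_def graph.sel V
      by (rule bij_betw_byWitness[where f' = "\<lambda>k. if k < c then (k, 0) else (0, k + 1 - c)"])
        (use assms in \<open>auto simp: image_iff\<close>)
    have "image ?f ` image (\<lambda>i. (i, 0)) ` cycle_edges c = cycle_edges c"
      by (simp add: image_image)
    moreover have "image ?f ` {{(0, 0), (0, Suc j)} | j. j < l} = {{0, c + j} | j. j < l}"
      by (simp add: setcompr_eq_image image_image)
    ultimately show "edges (cuttlefish c l) = image ?f ` edges (pendant_graph (cycle_edges c) ?w)"
      unfolding pendant_graph_def cuttlefish_def graph.sel L C image_Un by simp
  qed
  then show ?thesis by (simp add: cycle_csf_def)
qed

section \<open>Caterpillars and cuttlefish span\<close>

lemma sorted_wrt_replicate: "sorted_wrt (\<ge>) (replicate k (x :: nat))"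
  by (induction k) auto

lemma length_le_sum_list_partition:
  assumes "p \<in> partitions n"
  shows "length p \<le> n" "length p = n \<Longrightarrow> p = replicate n 1"
proof -
  have "length xs \<le> sum_list xs \<and> (length xs = sum_list xs \<longrightarrow> (\<forall>x\<in>set xs. x = 1))"
    if "\<forall>k\<in>set xs. 1 \<le> k" for xs :: "nat list"
    using that by (induction xs) auto
  from this[of p] have *: "length p \<le> n" "length p = n \<longrightarrow> (\<forall>x\<in>set p. x = 1)"
    using assms by (simp_all add: partitions_def)
  show "length p \<le> n" by fact
  show "p = replicate n 1" if "length p = n"
    using *(2) that by (auto intro: nth_equalityI)
qed

lemma num_stars_partition: "p \<in> partitions n \<Longrightarrow> num_stars p = length p"
  unfolding num_stars_def partitions_def by (auto intro!: arg_cong[where f = length] filter_True)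

lemma hook_in_partitions: "1 \<le> x \<Longrightarrow> x + k = n \<Longrightarrow> x # replicate k 1 \<in> partitions n"
  by (auto simp: partitions_def sum_list_replicate sorted_wrt_replicate)

text \<open>
  How a leading term is extracted: \<open>g\<close> is one of the given functions and \<open>g - c f\<close> consists of
  lower terms.
\<close>

lemma span_cancel:
  assumes "g \<in> series.span T" "g - qscale c f \<in> series.span T" "c \<noteq> 0"
  shows "f \<in> series.span T"
proof -
  have "f = qscale (1 / c) (g - (g - qscale c f))" using assms(3) by (simp add: fun_eq_iff qscale_def)
  then show ?thesis using series.span_scale[OF series.span_diff[OF assms(1,2)], of "1 / c"] by metis
qed

lemma partition_cases:
  assumes p: "p \<in> partitions n" and n: "0 < n"
  obtains "p = [n]" | "2 \<le> length p" "2 \<le> p ! 1" | x k where "1 \<le> k" "p = x # replicate k 1" "x + k = n" "1 \<le> x"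
proof (cases p)
  case Nil
  then show thesis using p n by (simp add: partitions_def)
next
  case (Cons x q)
  have q: "\<forall>y\<in>set q. 1 \<le> y" "sorted_wrt (\<ge>) q" and x: "1 \<le> x" "x + sum_list q = n"
    using p Cons by (auto simp: partitions_def)
  show thesis
  proof (cases q)
    case Nil
    then show thesis using that(1) Cons x by simp
  next
    case (Cons y r)
    show thesis
    proof (cases "2 \<le> y")
      case True
      then show thesis using that(2) \<open>p = x # q\<close> Cons by simp
    next
      case False
      then have "z = 1" if "z \<in> set q" for z using q that Cons by force
      then have q1: "q = replicate (length q) 1" by (intro replicate_length_same[symmetric]) auto
      then have "sum_list q = length q" using sum_list_replicate[of "length q" "1::nat"] by simp
      moreover have "1 \<le> length q" using Cons by simp
      ultimately show thesis using that(3)[of "length q" x] \<open>p = x # q\<close> x q1 by simp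
    qed
  qed
qed

text \<open>
  The cuttlefish yields \<open>h - (c-2)d\<close> with \<open>c = m + 2\<close>, and \<open>d\<close> itself comes from a caterpillar.
\<close>

lemma hook_in_span:
  assumes low: "star_span n (Suc m) 0 \<subseteq> series.span (caterpillar_csfs n \<union> cuttlefish_csfs n)"
    and m: "1 \<le> m" "x + m = n" "2 \<le> x"
  shows "star_csf (x # replicate m 1) \<in> series.span (caterpillar_csfs n \<union> cuttlefish_csfs n)"
proof -
  let ?D = "series.span (caterpillar_csfs n \<union> cuttlefish_csfs n)"
  obtain l where l: "x = Suc (Suc l)" using m(3) by (metis add_2_eq_Suc le_Suc_ex)
  obtain r where r: "m = Suc r" using m(1) by (cases m) auto
  define h where "h = star_csf (x # replicate m 1)"
  define d where "d = star_csf (Suc l # 2 # replicate r 1) - h"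
  have d: "d \<in> ?D"
  proof (cases l)
    case 0
    have "star_csf (Suc l # 2 # replicate r 1) = h"
      unfolding h_def by (rule star_csf_cong) (simp add: 0 l r)
    then have "d = 0" by (simp add: d_def)
    then show ?thesis using series.span_zero by metis
  next
    case (Suc l')
    let ?q = "Suc l # 2 # replicate r 1"
    have q: "?q \<in> partitions n"
      using m l r Suc by (auto simp: partitions_def sum_list_replicate sorted_wrt_replicate)
    then have "csf (caterpillar (rotate1 ?q)) \<in> caterpillar_csfs n"
      unfolding caterpillar_csfs_def by (intro CollectI exI[of _ ?q]) simp
    then have C: "path_csf (r + 2) ([2] @ replicate r 1 @ [Suc l] @ []) \<in> ?D"
      unfolding csf_caterpillar by (intro series.span_base) simp
    have e1: "star_csf ([2, Suc l] @ replicate r 1 @ []) = star_csf ?q"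
      by (rule star_csf_cong) simp
    have e2: "star_csf ([2 + Suc l - 1, 1] @ replicate r 1 @ []) = h"
      unfolding h_def by (rule star_csf_cong) (simp add: l r)
    have e3: "2 + Suc l + r + sum_list [] = n" "num_stars [] + r + 2 = Suc m"
      using m l r by (simp_all add: num_stars_def)
    have "path_csf (r + 2) ([2] @ replicate r 1 @ [Suc l] @ []) - qscale ((-1) ^ r) d \<in> ?D"
      using two_part_caterpillar[of 2 "Suc l" r "[]", OF zero_less_numeral zero_less_Suc] low
      unfolding e1 e2 e3 d_def by blast
    from span_cancel[OF C this] show ?thesis by simp
  qed
  have N: "3 \<le> m + 2" "m + 2 \<le> n" "n - (m + 2) = l" using m l by auto
  have C: "csf (cuttlefish (m + 2) l) \<in> ?D"
    using N unfolding cuttlefish_csfs_def by (intro series.span_base) blast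
  \<comment> \<open>The cuttlefish with cycle length \<open>c = m + 2\<close> has \<open>c - 1 = Suc m\<close> stars to leading order, as many as the hook.\<close>
  have eq: "l + (m + 2) = n" "m + 2 - 1 = Suc m" "m + 2 - 2 = m" "m + 2 - 3 = r"
    using m l r by auto
  have "csf (cuttlefish (m + 2) l) - qscale ((-1) ^ (m + 2)) (h - qscale (of_nat m) d) \<in> star_span n (Suc m) 0"
    using cycle_csf_hook[of "m + 2" "m + 2" l, OF _ order_refl]
    unfolding csf_cuttlefish[OF N(1)] d_def h_def l eq by simp
  then have "csf (cuttlefish (m + 2) l) - qscale ((-1) ^ (m + 2)) (h - qscale (of_nat m) d) \<in> ?D"
    using low by blast
  from span_cancel[OF C this] have "h - qscale (of_nat m) d \<in> ?D" by simp
  from series.span_add[OF this series.span_scale[OF d, of "of_nat m"]] show ?thesis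
    by (simp add: h_def)
qed

text \<open>
  A single part is a star, and partitions with a second part above 1 are the leading terms of
  caterpillars. The others are hooks, to which the induction hypothesis applies only through terms with fewer stars.
\<close>

lemma star_csf_in_span:
  assumes "sum_list w = n" "num_stars w < n"
  shows "star_csf w \<in> series.span (caterpillar_csfs n \<union> cuttlefish_csfs n)"
  using assms
proof (induction w rule: wf_induct_rule[OF wf_measures[of "[num_stars, num_proper_stars]"]])
  case (1 w)
  let ?D = "series.span (caterpillar_csfs n \<union> cuttlefish_csfs n)"
  define p where "p = partition_of w"
  have p: "p \<in> partitions n" using partition_of_in_partitions[of w] 1 by (simp add: p_def)
  have len: "length p = num_stars w" "num_proper_stars p = num_proper_stars w"
    by (simp_all add: p_def num_partition_of)
  have low: "star_span n (num_stars w) (num_proper_stars w) \<subseteq> ?D"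
    unfolding star_span_def
  proof (rule series.span_minimal[OF _ series.subspace_span], clarify)
    fix v :: "nat list" assume v: "n = sum_list v"
      "num_stars v < num_stars w \<or> num_stars v = num_stars w \<and> num_proper_stars v < num_proper_stars w"
    have "star_csf v \<in> series.span (caterpillar_csfs n \<union> cuttlefish_csfs n)"
      using v 1 by (intro "1.IH") auto
    then show "star_csf v \<in> series.span (caterpillar_csfs (sum_list v) \<union> cuttlefish_csfs (sum_list v))"
      using v(1) by simp
  qed
  have "star_csf p \<in> ?D"
  proof (rule partition_cases[OF p])
    show "0 < n" using 1 by simp
  next
    \<comment> \<open>The caterpillar with a single spine vertex is the star itself.\<close>
    assume pn: "p = [n]"
    then have "csf (caterpillar (rotate1 p)) \<in> caterpillar_csfs n"
      using p unfolding caterpillar_csfs_def by blast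
    moreover have "csf (caterpillar (rotate1 p)) = star_csf p"
      by (simp add: csf_caterpillar pn path_csf_1)
    ultimately show ?thesis by (metis UnI1 series.span_base)
  next
    assume l: "2 \<le> length p" "2 \<le> p ! 1"
    obtain c where c: "c \<noteq> 0" "csf (caterpillar (rotate1 p)) - qscale c (star_csf p) \<in> star_span n (length p) (num_proper_stars p)"
      using caterpillar_leading[OF p l] .
    have C: "csf (caterpillar (rotate1 p)) \<in> ?D"
      using p l unfolding caterpillar_csfs_def by (intro series.span_base) blast
    show ?thesis by (rule span_cancel[OF C _ c(1)]) (use c(2) low len in auto)
  next
    fix x k assume k: "1 \<le> k" "p = x # replicate k 1" "x + k = n" "1 \<le> x"
    \<comment> \<open>Both the cuttlefish and the caterpillar belonging to a hook only bring in fewer stars.\<close>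
    have "Suc k = num_stars w" using k(2) len(1) by simp
    then have "star_span n (Suc k) 0 \<subseteq> ?D" "2 \<le> x"
      using low star_span_mono[of "Suc k" "Suc k" 0 "num_proper_stars w"] 1 k by auto
    then show ?thesis using hook_in_span k by simp
  qed
  then show ?case by (simp add: p_def star_csf_partition_of)
qed

section \<open>Connectedness\<close>

text \<open>
  The space is spanned by graphs on natural numbers, so vertices of other types are renumbered first.
  By symmetry of adjacency, connectedness need only be checked towards a fixed root.
\<close>

lemma csf_in_connected_csf_space:
  fixes G :: "'a graph"
  assumes G: "simple_graph G" "card (verts G) = n"
    and r: "r \<in> verts G" "\<And>v. v \<in> verts G \<Longrightarrow> (v, r) \<in> {(x, y). {x, y} \<in> edges G}\<^sup>*"
  shows "csf G \<in> connected_csf_space n"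
proof -
  have fin: "finite (verts G)" using G by (simp add: simple_graph_def)
  obtain h where h: "bij_betw h (verts G) {0..<card (verts G)}"
    using ex_bij_betw_finite_nat[OF fin] by blast
  define H where "H = Graph (h ` verts G) (image h ` edges G)"
  have bij: "bij_betw h (verts G) (verts H)" using h by (auto simp: H_def bij_betw_def)
  have E: "edges H = image h ` edges G" by (simp add: H_def)
  have H: "simple_graph H" by (rule simple_graph_isomorphic[OF G(1) bij E])
  let ?R = "{(x, y). {x, y} \<in> edges H}"
  have toroot: "(h v, h r) \<in> ?R\<^sup>*" if "v \<in> verts G" for v
    using r(2)[OF that]
  proof (induction rule: converse_rtrancl_induct)
    case (step x y)
    then have "h ` {x, y} \<in> edges H" unfolding E by blast
    then have "(h x, h y) \<in> ?R" by simp
    then show ?case using step(3) by (rule converse_rtrancl_into_rtrancl)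
  qed simp
  have "sym ?R" by (auto simp: sym_def insert_commute)
  then have "sym (?R\<^sup>*)" by (rule sym_rtrancl)
  then have fromroot: "(h r, h v) \<in> ?R\<^sup>*" if "v \<in> verts G" for v
    using toroot[OF that] by (rule symD)
  have "(u, v) \<in> ?R\<^sup>*" if "u \<in> verts H" "v \<in> verts H" for u v
    using that toroot fromroot by (auto simp: H_def intro: rtrancl_trans)
  then have "connected_graph H"
    using r(1) unfolding connected_graph_def by (auto simp: H_def)
  moreover have "card (verts H) = n" using bij G(2) bij_betw_same_card by metis
  ultimately have "csf H \<in> connected_csf_space n"
    unfolding connected_csf_space_def using H by (intro series.span_base) blast
  then show ?thesis using csf_isomorphic[OF G(1) bij E] by simp
qed

lemma caterpillar_in_connected_csf_space:
  assumes "\<And>i. i < length \<alpha> \<Longrightarrow> 0 < \<alpha> ! i" "\<alpha> \<noteq> []" "sum_list \<alpha> = n"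
  shows "csf (caterpillar \<alpha>) \<in> connected_csf_space n"
proof (rule csf_in_connected_csf_space)
  show "simple_graph (caterpillar \<alpha>)"
    using simple_pendant_graph[OF base_path_edges[of "length \<alpha>" \<alpha>]] assms(1)
    by (simp add: caterpillar_pendant)
  have "verts (caterpillar \<alpha>) = (SIGMA i:{..<length \<alpha>}. {..<\<alpha> ! i})" by (auto simp: caterpillar_def)
  then show "card (verts (caterpillar \<alpha>)) = n"
    using assms(3) by (simp add: sum_list_sum_nth lessThan_atLeast0)
  show "(0, 0) \<in> verts (caterpillar \<alpha>)" using assms(1,2) by (simp add: caterpillar_def)
  let ?R = "{(x, y). {x, y} \<in> edges (caterpillar \<alpha>)}"
  have spine: "((i, 0), (0, 0)) \<in> ?R\<^sup>*" if "i < length \<alpha>" for i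
    using that
  proof (induction i)
    case (Suc i)
    then have "((Suc i, 0), (i, 0)) \<in> ?R" by (auto simp: caterpillar_def)
    then show ?case using Suc by (meson Suc_lessD converse_rtrancl_into_rtrancl)
  qed simp
  show "(v, (0, 0)) \<in> ?R\<^sup>*" if v: "v \<in> verts (caterpillar \<alpha>)" for v
  proof -
    obtain i j where ij: "v = (i, j)" "i < length \<alpha>" "j < \<alpha> ! i" using v by (auto simp: caterpillar_def)
    show ?thesis
    proof (cases "j = 0")
      case False
      then have "{(i, 0), (i, j)} \<in> edges (caterpillar \<alpha>)"
        using ij unfolding caterpillar_def graph.sel by blast
      then have "((i, j), (i, 0)) \<in> ?R" by (simp add: insert_commute)
      then show ?thesis unfolding ij(1) using spine[OF ij(2)] by (rule converse_rtrancl_into_rtrancl)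
    qed (use ij spine in simp)
  qed
qed

lemma cuttlefish_in_connected_csf_space:
  assumes "3 \<le> c" "c + l = n"
  shows "csf (cuttlefish c l) \<in> connected_csf_space n"
proof (rule csf_in_connected_csf_space)
  have "i \<noteq> Suc i mod c" "Suc i mod c < c" if "i < c" for i
    using that assms(1) by (auto simp: mod_Suc)
  then show "simple_graph (cuttlefish c l)"
    using assms(1) by (auto simp: simple_graph_def cuttlefish_def pair_card_2 intro: trans_less_add1)
  show "card (verts (cuttlefish c l)) = n" using assms(2) by (simp add: cuttlefish_def)
  show "0 \<in> verts (cuttlefish c l)" using assms(1) by (simp add: cuttlefish_def)
  let ?R = "{(x, y). {x, y} \<in> edges (cuttlefish c l)}"
  have ring: "(i, 0) \<in> ?R\<^sup>*" if "i < c" for i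
    using that
  proof (induction i)
    case (Suc i)
    have "{i, Suc i mod c} \<in> edges (cuttlefish c l)"
      using Suc.prems unfolding cuttlefish_def graph.sel by auto
    then have "(Suc i, i) \<in> ?R" using Suc.prems by (simp add: insert_commute)
    then show ?case using Suc by (meson Suc_lessD converse_rtrancl_into_rtrancl)
  qed simp
  show "(v, 0) \<in> ?R\<^sup>*" if v: "v \<in> verts (cuttlefish c l)" for v
  proof (cases "v < c")
    case False
    then obtain j where "v = c + j" "j < l"
      using v by (auto simp: cuttlefish_def dest: le_Suc_ex[OF leI])
    then have "{0, v} \<in> edges (cuttlefish c l)" unfolding cuttlefish_def graph.sel by blast
    then show ?thesis by (intro r_into_rtrancl) (simp add: insert_commute)
  qed (use ring in simp)
qed

section \<open>The coefficient of the partition into ones\<close>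

lemma csf_single_colour_eq_0:
  fixes G :: "'a graph"
  assumes "simple_graph G" "e \<in> edges G"
  shows "csf G (replicate_mset n 1) = 0"
proof -
  have fin: "finite (verts G)" and e: "e \<subseteq> verts G" "card e = 2"
    using assms by (auto simp: simple_graph_def)
  obtain u v where uv: "e = {u, v}" "u \<noteq> v" using e(2) by (meson card_2_iff)
  have "\<not> inj_on \<kappa> e" if "image_mset \<kappa> (mset_set (verts G)) = replicate_mset n 1" for \<kappa> :: "'a \<Rightarrow> nat"
  proof -
    have "\<kappa> ` verts G \<subseteq> {1}"
      using arg_cong[OF that, of set_mset] fin by (auto split: if_splits)
    then have "\<kappa> x = 1" if "x \<in> verts G" for x using that by (auto simp: image_subset_iff)
    then have "\<kappa> u = \<kappa> v" using e(1) uv(1) by simp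
    then show ?thesis using uv by auto
  qed
  then have none: "\<not> ((\<forall>e\<in>edges G. inj_on \<kappa> e) \<and> image_mset \<kappa> (mset_set (verts G)) = replicate_mset n 1)"
    for \<kappa> :: "'a \<Rightarrow> nat"
    using assms(2) by metis
  show ?thesis unfolding csf_inj_on_edges[OF assms(1)] by (simp only: none simp_thms empty_def[symmetric] card.empty of_nat_0)
qed

text \<open>
  The functional that extracts the coefficient of \<open>x\<^sub>1\<^sup>n\<close> singles out the partition into ones.
\<close>

lemma star_csf_single_colour:
  assumes "p \<in> partitions n"
  shows "star_csf p (replicate_mset n 1) = 0 \<longleftrightarrow> p \<noteq> replicate n 1"
proof
  have s: "simple_graph (star_forest p)" for p
    unfolding star_forest_pendant by (rule simple_pendant_graph) (simp add: base_edges_def)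
  show "p \<noteq> replicate n 1" if z: "star_csf p (replicate_mset n 1) = 0"
  proof
    assume p: "p = replicate n 1"
    let ?V = "verts (star_forest p)" let ?k = "restrict (\<lambda>_. 1 :: nat) ?V"
    have fin: "finite ?V" using s[of p] by (simp add: simple_graph_def)
    have V: "?V = (\<lambda>i. (i, 0)) ` {..<n}" and E: "edges (star_forest p) = {}"
      by (auto simp: star_forest_def p)
    have "image_mset ?k (mset_set ?V) = image_mset (\<lambda>_. 1) (mset_set ?V)"
      using fin by (intro image_mset_cong) auto
    also have "\<dots> = replicate_mset n 1"
      unfolding V by (simp add: image_mset_const_eq card_image inj_on_def)
    finally have "?k \<in> {\<kappa> \<in> proper_colourings (star_forest p). colouring_monomial (star_forest p) \<kappa> = replicate_mset n 1}"
      by (simp add: proper_colourings_def colouring_monomial_def E)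
    then have "card {\<kappa> \<in> proper_colourings (star_forest p). colouring_monomial (star_forest p) \<kappa> = replicate_mset n 1} \<noteq> 0"
      using finite_colourings_with_monomial[OF fin] by auto
    then show False using z by (simp add: star_csf_def csf_def)
  qed
  show "star_csf p (replicate_mset n 1) = 0" if "p \<noteq> replicate n 1"
  proof -
    obtain y where y: "y \<in> set p" "y \<noteq> 1"
    proof (rule ccontr)
      assume "\<not> thesis"
      then have "p = replicate (length p) 1" using that by (metis replicate_length_same)
      moreover have "sum_list (replicate (length p) (1::nat)) = length p" by (simp add: sum_list_replicate)
      moreover have "sum_list p = n" using assms by (simp add: partitions_def)
      ultimately show False using \<open>p \<noteq> replicate n 1\<close> by metis
    qed
    then obtain i where i: "i < length p" "p ! i \<noteq> 1" by (auto simp: in_set_conv_nth)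
    then have "1 < p ! i" using partition_nth_pos[OF assms] by (metis nat_neq_iff less_one)
    then have "{(i, 0), (i, 1)} \<in> edges (star_forest p)"
      using i unfolding star_forest_def graph.sel by auto
    then show ?thesis unfolding star_csf_def by (rule csf_single_colour_eq_0[OF s])
  qed
qed

lemma connected_graph_has_edge:
  assumes "connected_graph G" "2 \<le> card (verts G)"
  shows "edges G \<noteq> {}"
proof
  assume "edges G = {}"
  moreover obtain u v where "u \<in> verts G" "v \<in> verts G" "u \<noteq> v"
  proof -
    have "finite (verts G)" using assms(2) by (intro card_ge_0_finite) simp
    then have "\<not> (\<forall>u\<in>verts G. \<forall>v\<in>verts G. u = v)"
      using card_le_Suc0_iff_eq[of "verts G"] assms(2) by simp
    then show thesis using that by blast
  qed
  ultimately show False using assms(1) by (force simp: connected_graph_def)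
qed

section \<open>The space of connected graphs and its basis\<close>

text \<open>
  Linear combinations are indexed by all partitions, with zero coefficients outside \<open>S\<close>, to match
  the description of the space of connected graphs by a single vanishing coefficient.
\<close>

lemma span_star_csf_eq:
  assumes "S \<subseteq> partitions n"
  shows "series.span (star_csf ` S) =
    {(\<Sum>p\<in>partitions n. qscale (a p) (star_csf p)) | a. \<forall>p. p \<in> partitions n - S \<longrightarrow> a p = 0}"
proof (intro equalityI subsetI)
  have inj: "inj_on star_csf S" using star_csf_basis(1) assms by (rule inj_on_subset)
  have fin: "finite S" using finite_subset[OF assms finite_partitions] .
  fix f assume "f \<in> series.span (star_csf ` S)"
  then obtain u where u: "f = (\<Sum>v\<in>star_csf ` S. qscale (u v) v)"
    unfolding series.span_finite[OF finite_imageI[OF fin]] by auto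
  let ?a = "\<lambda>p. if p \<in> S then u (star_csf p) else 0"
  have "f = (\<Sum>p\<in>S. qscale (?a p) (star_csf p))"
    unfolding u sum.reindex[OF inj] by (intro sum.cong) auto
  also have "\<dots> = (\<Sum>p\<in>partitions n. qscale (?a p) (star_csf p))"
    using assms finite_partitions by (intro sum.mono_neutral_left) auto
  finally show "f \<in> {(\<Sum>p\<in>partitions n. qscale (a p) (star_csf p)) | a. \<forall>p. p \<in> partitions n - S \<longrightarrow> a p = 0}"
    by (intro CollectI exI[of _ ?a]) simp
next
  fix f assume "f \<in> {(\<Sum>p\<in>partitions n. qscale (a p) (star_csf p)) | a. \<forall>p. p \<in> partitions n - S \<longrightarrow> a p = 0}"
  then obtain a where a: "f = (\<Sum>p\<in>partitions n. qscale (a p) (star_csf p))" "\<forall>p. p \<in> partitions n - S \<longrightarrow> a p = 0"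
    by blast
  have "qscale (a p) (star_csf p) \<in> series.span (star_csf ` S)" if "p \<in> partitions n" for p
  proof (cases "p \<in> S")
    case False
    then have "qscale (a p) (star_csf p) = 0" using a(2) that by (simp add: series.scale_zero_left)
    then show ?thesis using series.span_zero by metis
  qed (intro series.span_scale series.span_base imageI)
  then show "f \<in> series.span (star_csf ` S)" unfolding a(1) by (rule series.span_sum)
qed

lemma caterpillars_and_cuttlefish_connected:
  assumes "0 < n"
  shows "caterpillar_csfs n \<union> cuttlefish_csfs n \<subseteq> connected_csf_space n"
proof (rule Un_least)
  show "caterpillar_csfs n \<subseteq> connected_csf_space n"
  proof
    fix f assume "f \<in> caterpillar_csfs n"
    then obtain p where f: "f = csf (caterpillar (rotate1 p))" and p: "p \<in> partitions n"
      unfolding caterpillar_csfs_def by blast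
    have "0 < rotate1 p ! i" if "i < length (rotate1 p)" for i
    proof -
      have "rotate1 p ! i \<in> set p" using nth_mem[OF that] by simp
      then show ?thesis using p by (auto simp: partitions_def)
    qed
    moreover have "rotate1 p \<noteq> []" "sum_list (rotate1 p) = n"
      using p assms by (cases p; simp add: partitions_def)+
    ultimately show "f \<in> connected_csf_space n" unfolding f by (rule caterpillar_in_connected_csf_space)
  qed
  show "cuttlefish_csfs n \<subseteq> connected_csf_space n"
    unfolding cuttlefish_csfs_def using cuttlefish_in_connected_csf_space by auto
qed

text \<open>
  Hooks \<open>(x,1^k)\<close> with \<open>x \<ge> 2\<close> and \<open>k \<ge> 1\<close> index the cuttlefish with cycle length \<open>k + 2\<close>,
  the other partitions apart from \<open>1\<^sup>n\<close> the caterpillars.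
\<close>

lemma card_caterpillars_and_cuttlefish:
  assumes "2 \<le> n"
  shows "finite (caterpillar_csfs n \<union> cuttlefish_csfs n)"
    "card (caterpillar_csfs n \<union> cuttlefish_csfs n) \<le> card (partitions n - {replicate n 1})"
proof -
  let ?T = "caterpillar_csfs n \<union> cuttlefish_csfs n" and ?S = "partitions n - {replicate n 1}"
  define g where "g p = (if p = [n] \<or> 2 \<le> length p \<and> 2 \<le> p ! 1 then csf (caterpillar (rotate1 p))
    else csf (cuttlefish (Suc (length p)) (n - Suc (length p))))" for p
  have sub: "?T \<subseteq> g ` ?S"
  proof (rule Un_least)
    show "caterpillar_csfs n \<subseteq> g ` ?S"
    proof
      fix f assume "f \<in> caterpillar_csfs n"
      then obtain p where f: "f = csf (caterpillar (rotate1 p))" and p: "p \<in> partitions n"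
        and c: "p = [n] \<or> 2 \<le> length p \<and> 2 \<le> p ! 1"
        unfolding caterpillar_csfs_def by blast
      have "p \<noteq> replicate n 1"
      proof
        assume e: "p = replicate n 1"
        then have "p ! 0 = 1" "p ! 1 = 1" "length p = n" using assms by (simp_all add: nth_replicate)
        then show False using c assms by auto
      qed
      then show "f \<in> g ` ?S" using f p c by (intro image_eqI[of _ _ p]) (simp_all add: g_def)
    qed
    show "cuttlefish_csfs n \<subseteq> g ` ?S"
    proof
      fix f assume "f \<in> cuttlefish_csfs n"
      then obtain c where f: "f = csf (cuttlefish c (n - c))" and c: "3 \<le> c" "c \<le> n"
        unfolding cuttlefish_csfs_def by blast
      let ?p = "(n - c + 2) # replicate (c - 2) 1"
      have "?p \<in> partitions n" by (rule hook_in_partitions) (use c in auto)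
      moreover have "?p \<noteq> replicate n 1" using c by (cases n) auto
      moreover have "g ?p = f"
      proof -
        have "\<not> (?p = [n] \<or> 2 \<le> length ?p \<and> 2 \<le> ?p ! 1)" "Suc (length ?p) = c"
          using c by auto
        then show ?thesis unfolding g_def f by (simp only: if_False)
      qed
      ultimately show "f \<in> g ` ?S" by blast
    qed
  qed
  have fin: "finite ?S" using finite_partitions by simp
  show "finite ?T" by (rule finite_subset[OF sub finite_imageI[OF fin]])
  show "card ?T \<le> card ?S"
    using card_mono[OF finite_imageI[OF fin] sub] card_image_le[OF fin, of g] by linarith
qed

theorem corollary4p25:
  fixes n :: nat
  assumes "n \<ge> 2"
  shows "connected_csf_space n =
           {(\<Sum>p\<in>partitions n. qscale (a p) (star_csf p)) | a :: nat list \<Rightarrow> rat.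
              a (replicate n 1) = 0} \<and>
         series.independent (caterpillar_csfs n \<union> cuttlefish_csfs n) \<and>
         series.span (caterpillar_csfs n \<union> cuttlefish_csfs n) = connected_csf_space n"
proof -
  let ?one = "replicate n (1::nat)" let ?S = "partitions n - {replicate n 1}"
  let ?T = "caterpillar_csfs n \<union> cuttlefish_csfs n"
  let ?R = "{(\<Sum>p\<in>partitions n. qscale (a p) (star_csf p)) | a :: nat list \<Rightarrow> rat. a (replicate n 1) = 0}"
  have one: "?one \<in> partitions n"
    by (simp add: partitions_def sum_list_replicate sorted_wrt_replicate)
  have R: "?R = series.span (star_csf ` ?S)"
    unfolding span_star_csf_eq[OF Diff_subset] using one by auto
  have "connected_csf_space n \<subseteq> ?R"
    unfolding connected_csf_space_def R
  proof (rule series.span_minimal[OF _ series.subspace_span], rule subsetI)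
    fix f assume "f \<in> {csf G | G :: nat graph. simple_graph G \<and> connected_graph G \<and> card (verts G) = n}"
    then obtain G :: "nat graph" where f: "f = csf G"
      and G: "simple_graph G" "connected_graph G" "card (verts G) = n" by blast
    have "csf G \<in> series.span (star_csf ` partitions n)"
      using csf_in_span_stars[OF G(1)] G(3) by simp
    then obtain a where a: "csf G = (\<Sum>p\<in>partitions n. qscale (a p) (star_csf p))"
      unfolding span_star_csf_eq[OF order_refl] by blast
    obtain e where "e \<in> edges G" using connected_graph_has_edge[OF G(2)] G(3) assms by blast
    then have "0 = (\<Sum>p\<in>partitions n. a p * star_csf p (replicate_mset n 1))"
      using csf_single_colour_eq_0[OF G(1), of e n] unfolding a by (simp add: sum_series_apply qscale_def)
    also have "\<dots> = (\<Sum>p\<in>partitions n. if p = ?one then a ?one * star_csf ?one (replicate_mset n 1) else 0)"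
      using star_csf_single_colour by (intro sum.cong) auto
    also have "\<dots> = a ?one * star_csf ?one (replicate_mset n 1)"
      using one finite_partitions by simp
    \<comment> \<open>Only the partition into ones has a star forest with a one-coloured proper colouring.\<close>
    finally have "a ?one = 0" using star_csf_single_colour[OF one] by auto
    then have "csf G \<in> ?R" using a by blast
    then show "f \<in> series.span (star_csf ` ?S)" unfolding R f .
  qed
  moreover have S: "star_csf ` ?S \<subseteq> series.span ?T"
  proof (rule image_subsetI)
    fix p assume "p \<in> ?S"
    then have p: "p \<in> partitions n" "p \<noteq> ?one" by auto
    then have "num_stars p < n"
      using length_le_sum_list_partition[OF p(1)] num_stars_partition[OF p(1)] le_neq_implies_less by metis
    then show "star_csf p \<in> series.span ?T"
      using p(1) by (intro star_csf_in_span) (auto simp: partitions_def)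
  qed
  moreover from S have "?R \<subseteq> series.span ?T"
    unfolding R by (rule series.span_minimal[OF _ series.subspace_span])
  moreover have "series.span ?T \<subseteq> connected_csf_space n"
    using caterpillars_and_cuttlefish_connected[OF less_le_trans[OF pos2 assms]] unfolding connected_csf_space_def
    by (rule series.span_minimal[OF _ series.subspace_span])
  moreover have "series.independent ?T"
  \<comment> \<open>There are no more generators than the independent \<open>star_csf p\<close> in their span.\<close>
  proof (rule spanning_card_le_independent[OF card_caterpillars_and_cuttlefish(1)[OF assms] _ S])
    show "series.independent (star_csf ` ?S)"
      using star_csf_basis(2) by (rule series.independent_mono) auto
    have "card (star_csf ` ?S) = card ?S"
      by (rule card_image[OF inj_on_subset[OF star_csf_basis(1) Diff_subset]])
    then show "card ?T \<le> card (star_csf ` ?S)"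
      using card_caterpillars_and_cuttlefish(2)[OF assms] by simp
  qed
  ultimately show ?thesis by blast
qed

end
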